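(* Let $n,m,N,a_k,b_{ij},g$ satisfy the standing assumptions in the context, and let $S,\Psi,\mathcal O_{++},\mathcal O_{+-},\mathcal O_{-+},\mathcal O_{--},\mathcal O_0,\mathcal O,A,s_{\max},s_{\min},\|g\|_r$ be as defined there. Suppose the following conditions hold. (C1) $\mathcal O_0$ is empty. (C2) There exist positive real numbers $c<d$ and real-valued functions $W_1,U_1$ on $\mathcal O_{++}$, $w_1,u_1$ on $\mathcal O_{+-}$, $W_2,U_2$ on $\mathcal O_{-+}$, $w_2,u_2$ on $\mathcal O_{--}$ such that - for $t\in\mathcal O_{++}$: $W_1(t)<g(t,x)$ for all $x\in[c,d]$, and $g(t,x)<U_1(t)$ for all $x\in[-d,-c]$; - for $t\in\mathcal O_{+-}$: $g(t,x)<u_1(t)$ for all $x\in[c,d]$, and $w_1(t)<g(t,x)$ for all $x\in[-d,-c]$; - for $t\in\mathcal O_{-+}$: $g(t,x)<W_2(t)$ for all $x\in[c,d]$, and $U_2(t)<g(t,x)$ for all $x\in[-d,-c]$; - for $t\in\mathcal O_{--}$: $u_2(t)<g(t,x)$ for all $x\in[c,d]$, and $g(t,x)<w_2(t)$ for all $x\in[-d,-c]$. (C3) $\displaystyle d>\frac{c\,s_{\max}+A\|g\|_d\,(s_{\max}+s_{\min})}{s_{\min}}$. (C4) $J_2\le 0\le J_1$, where $J_1=\sum_{i=0}^{N-1}[\Psi(i)]_nK_1(i)$ and $J_2=\sum_{i=0}^{N-1}[\Psi(i)]_nK_2(i)$, with $K_1$ equal to $W_1,w_1,W_2,w_2$ and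 $K_2$ equal to $U_1,u_1,U_2,u_2$ on $\mathcal O_{++},\mathcal O_{+-},\mathcal O_{-+},\mathcal O_{--}$ respectively (given (C1), every index $i\notin\mathcal O$ has $[\Psi(i)]_n=0$, and its term is taken to be $0$). Then there exists a solution of the nonlinear boundary value problem, that is, a function $y:\{0,1,\dots,N+n-1\}\to\mathbb R$ with $$y(t+n)+a_{n-1}(t)y(t+n-1)+\cdots+a_0(t)y(t)=g(t,y(t+m-1)),\qquad t=0,\dots,N-1,$$ and $$\sum_{k=0}^{N}\sum_{j=1}^{n}b_{ij}(k)\,y(j+k-1)=0,\qquad i=1,\dots,n.$$
   Context: Standing assumptions. $n\ge1$ and $N>2$ are integers, $m$ is a fixed integer with $1\le m\le n$, $g:\mathbb R\times\mathbb R\to\mathbb R$ is continuous, the coefficients $a_0(t),\dots,a_{n-1}(t)$ ($t=0,\dots,N-1$) and $b_{ij}(k)$ ($1\le i,j\le n$, $0\le k\le N$) are real, and $a_0(t)\ne0$ for all $t$. Let $A(t)$ be the $n\times n$ companion matrix with entries $1$ on the superdiagonal, last row $(-a_0(t),-a_1(t),\dots,-a_{n-1}(t))$, and all other entries $0$. Let $B_k$ be the $n\times n$ matrix $(B_k)_{ij}=b_{ij}(k)$. The boundary conditions are assumed independent: the augmented matrix $[B_0,\dots,B_N]$ has full row rank $n$. Let $\Phi(0)=I$ and $\Phi(t)=A(t-1)\cdots A(0)$ for $t=1,\dots,N$. The space of solutions of the linear homogeneous problem $x(t+1)=A(t)x(t)$ ($t=0,\dots,N-1$), $\sum_{k=0}^N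 B_kx(k)=0$, is assumed to be $1$-dimensional; equivalently, $D:=\sum_{k=0}^N B_k\Phi(k)$ has $1$-dimensional kernel. Fix a vector $u$ spanning $\ker D$ and a vector $w$ spanning $\ker D^T$. Define $S(t)=\Phi(t)u\in\mathbb R^n$ for $t=0,\dots,N$, and $\Psi(t)\in\mathbb R^n$ for $t=0,\dots,N-1$ by $\Psi^T(t)=\sum_{i=t+1}^N w^TB_i\Phi(i)\Phi^{-1}(t+1)$. $[e]_k$ denotes the $k$-th component of $e\in\mathbb R^n$. Spaces and operators. $X=\{\phi:\{0,\dots,N\}\to\mathbb R^n \mid \sum_{k=0}^N B_k\phi(k)=0\}$ and $Z=\{\phi:\{0,\dots,N-1\}\to\mathbb R^n\}$, both with the supremum norm $\|\phi\|=\max_t|\phi(t)|$, $|\cdot|$ the Euclidean norm. $\mathcal L:X\to Z$, $(\mathcal Lx)(t)=x(t+1)-A(t)x(t)$. $P:X\to X$, $[Px](t)=\Phi(t)Vx(0)$, where $V$ is the orthogonal projection of $\mathbb R^n$ onto $\ker D$; $P$ is a projection onto $\ker\mathcal L$. $Q:Z\to Z$, $[Qh](t)=\Psi(t)\big(\sum_{j=0}^{N-1}|\Psi(j)|^2\big)^{-1}\sum_{i=0}^{N-1}\Psi^T(i)h(i)$; $Q$ is well defined and $I-Q$ is a projection onto $\mathrm{Im}(\mathcal L)$. $M_p=(\mathcal L|_{\ker P})^{-1}:\mathrm{Im}(\mathcal L)\to\ker P$. Sets and constants. With $t$ ranging over $\{0,\dots,N-1\}$: $\mathcal O_{++}=\{t: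 [\Psi(t)]_n>0,[S(t)]_m>0\}$, $\mathcal O_{+-}=\{t:[\Psi(t)]_n>0,[S(t)]_m<0\}$, $\mathcal O_{-+}=\{t:[\Psi(t)]_n<0,[S(t)]_m>0\}$, $\mathcal O_{--}=\{t:[\Psi(t)]_n<0,[S(t)]_m<0\}$, $\mathcal O_0=\{t:[\Psi(t)]_n\ne0,[S(t)]_m=0\}$, $\mathcal O=\mathcal O_{++}\cup\mathcal O_{+-}\cup\mathcal O_{-+}\cup\mathcal O_{--}$. $A=\|M_p(I-Q)\|$ (operator norm from $Z$ to $X$; the constant $A$ is distinct from the matrices $A(t)$), $s_{\max}=\max_{t\in\{0,\dots,N-1\}}|[S(t)]_m|$, $s_{\min}=\min_{t\in\mathcal O}|[S(t)]_m|$ (it is understood that $\mathcal O\neq\emptyset$, so that this minimum is defined), $\|g\|_r=\sup\{|g(t,x)| : t\in\{0,\dots,N-1\},\,x\in[-r,r]\}$. *)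

theory Defs
  imports
    Complex_Main
    "HOL-Library.FuncSet"
    "Jordan_Normal_Form.Gauss_Jordan_Elimination"
    "Jordan_Normal_Form.Matrix_Kernel"
    "Jordan_Normal_Form.DL_Rank"
begin

text \<open>
  Vectors and matrices over the reals are those of Jordan_Normal_Form, whose entries are indexed
  from 0.  The data of the boundary value problem keep their customary indices: \<open>a j t\<close> stands for
  $a_j(t)$ with $0 \le j < n$, and \<open>b i j k\<close> for $b_{ij}(k)$ with $1 \le i,j \le n$.  Hence the
  component $[e]_k$ of a vector is \<open>e $ (k - 1)\<close>.
\<close>

section \<open>The linear problem\<close>

definition companion :: "nat \<Rightarrow> (nat \<Rightarrow> nat \<Rightarrow> real) \<Rightarrow> nat \<Rightarrow> real mat" where
  "companion n a t =
     mat n n (\<lambda>(i, j). if i = n - 1 then - a j t else if j = i + 1 then 1 else 0)"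

definition bmat :: "nat \<Rightarrow> (nat \<Rightarrow> nat \<Rightarrow> nat \<Rightarrow> real) \<Rightarrow> nat \<Rightarrow> real mat" where
  "bmat n b k = mat n n (\<lambda>(i, j). b (i + 1) (j + 1) k)"

definition augmented :: "nat \<Rightarrow> nat \<Rightarrow> (nat \<Rightarrow> nat \<Rightarrow> nat \<Rightarrow> real) \<Rightarrow> real mat" where
  "augmented n N b = mat_of_cols n (concat (map (\<lambda>k. cols (bmat n b k)) [0..<N + 1]))"

primrec Phi :: "nat \<Rightarrow> (nat \<Rightarrow> nat \<Rightarrow> real) \<Rightarrow> nat \<Rightarrow> real mat" where
  "Phi n a 0 = 1\<^sub>m n"
| "Phi n a (Suc t) = companion n a t * Phi n a t"

definition Dmat :: "nat \<Rightarrow> nat \<Rightarrow> (nat \<Rightarrow> nat \<Rightarrow> real) \<Rightarrow> (nat \<Rightarrow> nat \<Rightarrow> nat \<Rightarrow> real) \<Rightarrow> real mat"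
where
  "Dmat n N a b = finsum (module_mat TYPE(real) n n) (\<lambda>k. bmat n b k * Phi n a k) {0..N}"

definition spans_line :: "real vec \<Rightarrow> real vec set \<Rightarrow> bool" where
  "spans_line v K \<longleftrightarrow> K = {c \<cdot>\<^sub>v v | c. True}"

definition Svec :: "nat \<Rightarrow> (nat \<Rightarrow> nat \<Rightarrow> real) \<Rightarrow> real vec \<Rightarrow> nat \<Rightarrow> real vec" where
  "Svec n a u t = Phi n a t *\<^sub>v u"

text \<open>
  The row vector $\Psi^T(t) = \sum_{i>t} w^T B_i \Phi(i) \Phi^{-1}(t+1)$ is transposed into a
  column.  The matrices $\Phi(t)$, $t \le N$, are invertible when $a_0$ does not vanish, so
  \<^const>\<open>mat_inverse\<close> does return a matrix.
\<close>

definition Psi ::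
  "nat \<Rightarrow> nat \<Rightarrow> (nat \<Rightarrow> nat \<Rightarrow> real) \<Rightarrow> (nat \<Rightarrow> nat \<Rightarrow> nat \<Rightarrow> real) \<Rightarrow> real vec \<Rightarrow> nat \<Rightarrow> real vec"
where
  "Psi n N a b w t =
     finsum_vec TYPE(real) n
       (\<lambda>i. transpose_mat (bmat n b i * Phi n a i * the (mat_inverse (Phi n a (t + 1)))) *\<^sub>v w)
       {t + 1..N}"


section \<open>Spaces and operators\<close>

text \<open>
  Functions on a finite set of times are extensional, so that distinct elements of the function
  spaces differ at some time.
\<close>

definition vnorm :: "real vec \<Rightarrow> real" where
  "vnorm v = sqrt (v \<bullet> v)"

definition supnorm :: "nat set \<Rightarrow> (nat \<Rightarrow> real vec) \<Rightarrow> real" where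
  "supnorm T \<phi> = Max ((\<lambda>t. vnorm (\<phi> t)) ` T)"

definition Xspace :: "nat \<Rightarrow> nat \<Rightarrow> (nat \<Rightarrow> nat \<Rightarrow> nat \<Rightarrow> real) \<Rightarrow> (nat \<Rightarrow> real vec) set" where
  "Xspace n N b =
     {\<phi> \<in> {0..N} \<rightarrow>\<^sub>E carrier_vec n.
        finsum_vec TYPE(real) n (\<lambda>k. bmat n b k *\<^sub>v \<phi> k) {0..N} = 0\<^sub>v n}"

definition Zspace :: "nat \<Rightarrow> nat \<Rightarrow> (nat \<Rightarrow> real vec) set" where
  "Zspace n N = {0..<N} \<rightarrow>\<^sub>E carrier_vec n"

definition Lop ::
  "nat \<Rightarrow> nat \<Rightarrow> (nat \<Rightarrow> nat \<Rightarrow> real) \<Rightarrow> (nat \<Rightarrow> real vec) \<Rightarrow> nat \<Rightarrow> real vec" where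
  "Lop n N a x = (\<lambda>t\<in>{0..<N}. x (t + 1) - companion n a t *\<^sub>v x t)"

definition orth_proj :: "real vec set \<Rightarrow> real vec \<Rightarrow> real vec" where
  "orth_proj K v = (THE p. p \<in> K \<and> (\<forall>z\<in>K. (v - p) \<bullet> z = 0))"

definition Pop ::
  "nat \<Rightarrow> nat \<Rightarrow> (nat \<Rightarrow> nat \<Rightarrow> real) \<Rightarrow> (nat \<Rightarrow> nat \<Rightarrow> nat \<Rightarrow> real)
     \<Rightarrow> (nat \<Rightarrow> real vec) \<Rightarrow> nat \<Rightarrow> real vec" where
  "Pop n N a b x =
     (\<lambda>t\<in>{0..N}. Phi n a t *\<^sub>v orth_proj (mat_kernel (Dmat n N a b)) (x 0))"

definition kerP ::
  "nat \<Rightarrow> nat \<Rightarrow> (nat \<Rightarrow> nat \<Rightarrow> real) \<Rightarrow> (nat \<Rightarrow> nat \<Rightarrow> nat \<Rightarrow> real) \<Rightarrow> (nat \<Rightarrow> real vec) set"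
where
  "kerP n N a b = {x \<in> Xspace n N b. Pop n N a b x = (\<lambda>t\<in>{0..N}. 0\<^sub>v n)}"

definition Qop ::
  "nat \<Rightarrow> nat \<Rightarrow> (nat \<Rightarrow> nat \<Rightarrow> real) \<Rightarrow> (nat \<Rightarrow> nat \<Rightarrow> nat \<Rightarrow> real) \<Rightarrow> real vec
     \<Rightarrow> (nat \<Rightarrow> real vec) \<Rightarrow> nat \<Rightarrow> real vec" where
  "Qop n N a b w h =
     (\<lambda>t\<in>{0..<N}.
        (inverse (\<Sum>j = 0..<N. (vnorm (Psi n N a b w j))\<^sup>2)
           * (\<Sum>i = 0..<N. Psi n N a b w i \<bullet> h i)) \<cdot>\<^sub>v Psi n N a b w t)"

definition Mp ::
  "nat \<Rightarrow> nat \<Rightarrow> (nat \<Rightarrow> nat \<Rightarrow> real) \<Rightarrow> (nat \<Rightarrow> nat \<Rightarrow> nat \<Rightarrow> real)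
     \<Rightarrow> (nat \<Rightarrow> real vec) \<Rightarrow> nat \<Rightarrow> real vec" where
  "Mp n N a b = the_inv_into (kerP n N a b) (Lop n N a)"

definition MpIQ ::
  "nat \<Rightarrow> nat \<Rightarrow> (nat \<Rightarrow> nat \<Rightarrow> real) \<Rightarrow> (nat \<Rightarrow> nat \<Rightarrow> nat \<Rightarrow> real) \<Rightarrow> real vec
     \<Rightarrow> (nat \<Rightarrow> real vec) \<Rightarrow> nat \<Rightarrow> real vec" where
  "MpIQ n N a b w h = Mp n N a b (\<lambda>t\<in>{0..<N}. h t - Qop n N a b w h t)"

definition opnorm_ZX ::
  "nat \<Rightarrow> nat \<Rightarrow> ((nat \<Rightarrow> real vec) \<Rightarrow> nat \<Rightarrow> real vec) \<Rightarrow> real" where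
  "opnorm_ZX n N T = (SUP h\<in>{h \<in> Zspace n N. supnorm {0..<N} h \<le> 1}. supnorm {0..N} (T h))"


section \<open>Sets and constants\<close>

definition Psi_n ::
  "nat \<Rightarrow> nat \<Rightarrow> (nat \<Rightarrow> nat \<Rightarrow> real) \<Rightarrow> (nat \<Rightarrow> nat \<Rightarrow> nat \<Rightarrow> real) \<Rightarrow> real vec \<Rightarrow> nat \<Rightarrow> real"
where
  "Psi_n n N a b w t = Psi n N a b w t $ (n - 1)"

definition S_m :: "nat \<Rightarrow> nat \<Rightarrow> (nat \<Rightarrow> nat \<Rightarrow> real) \<Rightarrow> real vec \<Rightarrow> nat \<Rightarrow> real" where
  "S_m n m a u t = Svec n a u t $ (m - 1)"

text \<open>
  In what follows \<open>\<psi>\<close> and \<open>s\<close> are the scalar sequences $[\Psi(t)]_n$ and $[S(t)]_m$.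
\<close>

definition Opp :: "nat \<Rightarrow> (nat \<Rightarrow> real) \<Rightarrow> (nat \<Rightarrow> real) \<Rightarrow> nat set" where
  "Opp N \<psi> s = {t \<in> {0..<N}. \<psi> t > 0 \<and> s t > 0}"

definition Opm :: "nat \<Rightarrow> (nat \<Rightarrow> real) \<Rightarrow> (nat \<Rightarrow> real) \<Rightarrow> nat set" where
  "Opm N \<psi> s = {t \<in> {0..<N}. \<psi> t > 0 \<and> s t < 0}"

definition Omp :: "nat \<Rightarrow> (nat \<Rightarrow> real) \<Rightarrow> (nat \<Rightarrow> real) \<Rightarrow> nat set" where
  "Omp N \<psi> s = {t \<in> {0..<N}. \<psi> t < 0 \<and> s t > 0}"

definition Omm :: "nat \<Rightarrow> (nat \<Rightarrow> real) \<Rightarrow> (nat \<Rightarrow> real) \<Rightarrow> nat set" where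
  "Omm N \<psi> s = {t \<in> {0..<N}. \<psi> t < 0 \<and> s t < 0}"

definition Ozero :: "nat \<Rightarrow> (nat \<Rightarrow> real) \<Rightarrow> (nat \<Rightarrow> real) \<Rightarrow> nat set" where
  "Ozero N \<psi> s = {t \<in> {0..<N}. \<psi> t \<noteq> 0 \<and> s t = 0}"

definition Oall :: "nat \<Rightarrow> (nat \<Rightarrow> real) \<Rightarrow> (nat \<Rightarrow> real) \<Rightarrow> nat set" where
  "Oall N \<psi> s = Opp N \<psi> s \<union> Opm N \<psi> s \<union> Omp N \<psi> s \<union> Omm N \<psi> s"

definition smax :: "nat \<Rightarrow> (nat \<Rightarrow> real) \<Rightarrow> real" where
  "smax N s = Max ((\<lambda>t. \<bar>s t\<bar>) ` {0..<N})"

definition smin :: "nat \<Rightarrow> (nat \<Rightarrow> real) \<Rightarrow> (nat \<Rightarrow> real) \<Rightarrow> real" where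
  "smin N \<psi> s = Min ((\<lambda>t. \<bar>s t\<bar>) ` Oall N \<psi> s)"

definition gnorm :: "nat \<Rightarrow> (real \<times> real \<Rightarrow> real) \<Rightarrow> real \<Rightarrow> real" where
  "gnorm N g r = (SUP (t, x)\<in>{0..<N} \<times> {-r..r}. \<bar>g (real t, x)\<bar>)"

definition glue ::
  "nat \<Rightarrow> (nat \<Rightarrow> real) \<Rightarrow> (nat \<Rightarrow> real)
     \<Rightarrow> (nat \<Rightarrow> real) \<Rightarrow> (nat \<Rightarrow> real) \<Rightarrow> (nat \<Rightarrow> real) \<Rightarrow> (nat \<Rightarrow> real) \<Rightarrow> nat \<Rightarrow> real" where
  "glue N \<psi> s fpp fpm fmp fmm t =
     (if t \<in> Opp N \<psi> s then fpp t
      else if t \<in> Opm N \<psi> s then fpm t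
      else if t \<in> Omp N \<psi> s then fmp t
      else if t \<in> Omm N \<psi> s then fmm t
      else 0)"

end

theory Submission
  imports "HOL-Analysis.Brouwer_Fixpoint" Defs
begin

unbundle no vec_syntax
unbundle no inner_syntax

text \<open>
  Lyapunov--Schmidt reduction: with $F$ the superposition operator, a solution of the system has the
  form $x = \alpha S + M_p (I - Q) F(x)$ with $\sum_t [\Psi(t)]_n\, g(t, [x(t)]_m) = 0$.  Only the
  scalars $z_t = [M_p (I - Q) F(x)]_m(t)$ enter $g$, so this is a system of $N + 1$ equations for
  $(\alpha, z_0, \dots, z_{N-1})$.  On the box $|z_t| \le \beta = A \|g\|_d$,
  $|\alpha| \le (c + \beta) / s_{\min}$, condition (C3) keeps all arguments of $g$ in $[-d, d]$; on
  the two faces where $|\alpha|$ is maximal the arguments with $t \in \mathcal{O}$ lie beyond $\pm c$,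
  so (C2) and (C4) give the solvability sum opposite signs there.  The Poincare--Miranda theorem
  yields a zero.  It is derived from Kuhn's lemma, because Brouwer's theorem in the library needs
  a dimension that is a type, and here it is the variable $N + 1$.
\<close>

section \<open>The Poincare--Miranda theorem\<close>

text \<open>\<open>opnorm_ZX\<close> and \<open>gnorm\<close> are suprema in the reals, and such a
  supremum bounds nothing until its set is known to be bounded above. For A this is a statement
  about M_p (I - Q), where M_p is itself a chosen inverse: injectivity of L on ker P and
  surjectivity onto the functions orthogonal to Psi make that inverse meaningful, uniqueness makes
  M_p (I - Q) linear, and expansion in the finite standard basis of Z makes it bounded. The same
  expansion supplies the coefficients of the scalar system. The bound (c + beta) / s_min for alpha
  answers two demands: its product with s_min exceeds beta by exactly c, which pushes the arguments
  with t in O beyond c, and its product with s_max plus beta is the right-hand side of (C3).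
  Vanishing of the solvability sum means Q F(x) = 0, so I - Q acts trivially at the zero found and
  the reduced equation becomes the full one. Since O is nonempty, Psi is not identically zero, and
  the denominator in Q does not vanish.\<close>

lemma bounded_real_seqs_convergent_subseq:
  fixes X :: "nat \<Rightarrow> nat \<Rightarrow> real"
  assumes "\<And>k i. i < n \<Longrightarrow> X k i \<in> {lo i..hi i}"
  obtains r l where "strict_mono r" "\<And>i. i < n \<Longrightarrow> (\<lambda>k. X (r k) i) \<longlonglongrightarrow> l i"
  using assms
proof (induction n arbitrary: thesis)
  case 0
  show ?case by (rule 0(1)[of id]) (auto simp: strict_mono_def)
next
  case (Suc n)
  obtain r l where r: "strict_mono r" "\<And>i. i < n \<Longrightarrow> (\<lambda>k. X (r k) i) \<longlonglongrightarrow> l i"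
    using Suc.IH Suc.prems(2) by (metis less_Suc_eq)
  have "seq_compact {lo n..hi n}"
    by (simp add: compact_imp_seq_compact)
  then obtain y r' where r': "strict_mono r'" "((\<lambda>k. X (r k) n) \<circ> r') \<longlonglongrightarrow> y"
    by (rule seq_compactE[where f = "\<lambda>k. X (r k) n"]) (use Suc.prems(2) in auto)
  show ?case
  proof (rule Suc.prems(1)[of "r \<circ> r'" "l(n := y)"])
    show "strict_mono (r \<circ> r')"
      using r(1) r'(1) by (rule strict_mono_o)
    fix i assume "i < Suc n"
    show "(\<lambda>k. X ((r \<circ> r') k) i) \<longlonglongrightarrow> (l(n := y)) i"
    proof (cases "i = n")
      case True
      then show ?thesis using r'(2) by (simp add: o_def)
    next
      case False
      then have "i < n" using \<open>i < Suc n\<close> by simp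
      from LIMSEQ_subseq_LIMSEQ[OF r(2)[OF this] r'(1)] show ?thesis
        using False by (simp add: o_def)
    qed
  qed
qed

text \<open>Kuhn's lemma on ever finer grids gives small cells in which every \<open>f i\<close>
  takes both signs; a limit of such cells is a common zero. Continuity is sequential in the
  coordinates below \<open>n\<close>, so it also forces \<open>f i\<close> to depend on these
  coordinates only.\<close>

theorem poincare_miranda:
  fixes f :: "nat \<Rightarrow> (nat \<Rightarrow> real) \<Rightarrow> real" and lo hi :: "nat \<Rightarrow> real"
  assumes box: "\<And>i. i < n \<Longrightarrow> lo i \<le> hi i"
    and cont: "\<And>i X l. i < n \<Longrightarrow> (\<And>j. j < n \<Longrightarrow> (\<lambda>k. X k j) \<longlonglongrightarrow> l j) \<Longrightarrow> (\<lambda>k. f i (X k)) \<longlonglongrightarrow> f i l"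
    and lo: "\<And>i x. i < n \<Longrightarrow> (\<And>j. j < n \<Longrightarrow> x j \<in> {lo j..hi j}) \<Longrightarrow> x i = lo i \<Longrightarrow> f i x \<le> 0"
    and hi: "\<And>i x. i < n \<Longrightarrow> (\<And>j. j < n \<Longrightarrow> x j \<in> {lo j..hi j}) \<Longrightarrow> x i = hi i \<Longrightarrow> 0 \<le> f i x"
  obtains x where "\<And>i. i < n \<Longrightarrow> x i \<in> {lo i..hi i}" "\<And>i. i < n \<Longrightarrow> f i x = 0"
proof -
  \<comment> \<open>\<open>T p q\<close> is the point of the box with grid index \<open>q\<close>,
    where each side is divided into \<open>p\<close> equal pieces.\<close>
  define T where "T p q i = lo i + (hi i - lo i) * (real (q i) / real p)" for p :: nat and q :: "nat \<Rightarrow> nat" and i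
  have T_box: "T p q i \<in> {lo i..hi i}" if "i < n" "q i \<le> p" "0 < p" for p q i
  proof -
    have "0 \<le> (hi i - lo i) * (real (q i) / real p)"
      using box[OF that(1)] by simp
    moreover have "(hi i - lo i) * (real (q i) / real p) \<le> (hi i - lo i) * 1"
      using box[OF that(1)] that by (intro mult_left_mono) auto
    ultimately show ?thesis unfolding T_def by auto
  qed
  have "\<exists>q r s. (\<forall>i<n. q i < p) \<and>
      (\<forall>i<n. (\<forall>j<n. q j \<le> r i j \<and> r i j \<le> q j + 1 \<and> q j \<le> s i j \<and> s i j \<le> q j + 1) \<and>
         f i (T p (r i)) \<le> 0 \<and> 0 \<le> f i (T p (s i)))" if p: "0 < p" for p :: nat
  proof -
    \<comment> \<open>Kuhn's lemma prescribes label 0 on the lower faces and 1 on the upper ones.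
      The sign hypotheses on the faces make these forced labels agree with the sign of
      \<open>f i\<close>, so label 0 always means \<open>f i\<close> nonpositive and label 1
      nonnegative.\<close>
    define label where "label q i =
      (if q i = 0 then 0 else if q i = p then 1 else if f i (T p q) \<le> 0 then 0 else 1::nat)" for q i
    have neg: "f i (T p q) \<le> 0" if "label q i = 0" "i < n" "\<forall>j<n. q j \<le> p" for q i
      using that lo[OF that(2), of "T p q"] T_box[OF _ _ p] p
      by (cases "q i = 0") (auto simp: label_def T_def[of p q i] split: if_splits)
    have pos: "0 \<le> f i (T p q)" if "label q i \<noteq> 0" "i < n" "\<forall>j<n. q j \<le> p" for q i
      using that hi[OF that(2), of "T p q"] T_box[OF _ _ p] p
      by (cases "q i = p") (auto simp: label_def T_def[of p q i] split: if_splits)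
    obtain q where q: "\<forall>i<n. q i < p"
      and rs: "\<forall>i<n. \<exists>r s. (\<forall>j<n. q j \<le> r j \<and> r j \<le> q j + 1) \<and>
        (\<forall>j<n. q j \<le> s j \<and> s j \<le> q j + 1) \<and> label r i \<noteq> label s i"
      by (rule kuhn_lemma[of p n label]) (use p in \<open>auto simp: label_def\<close>)
    have "\<exists>r s. (\<forall>j<n. q j \<le> r j \<and> r j \<le> q j + 1 \<and> q j \<le> s j \<and> s j \<le> q j + 1) \<and>
        f i (T p r) \<le> 0 \<and> 0 \<le> f i (T p s)" if i: "i < n" for i
    proof -
      obtain r s where r: "\<forall>j<n. q j \<le> r j \<and> r j \<le> q j + 1"
        and s: "\<forall>j<n. q j \<le> s j \<and> s j \<le> q j + 1" and ne: "label r i \<noteq> label s i"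
        using rs i by blast
      have le: "\<forall>j<n. r j \<le> p" "\<forall>j<n. s j \<le> p"
        using q r s by (metis Suc_eq_plus1 Suc_leI le_trans)+
      have "label r i = 0 \<or> label s i = 0" "label r i \<noteq> 0 \<or> label s i \<noteq> 0"
        using ne p by (auto simp: label_def split: if_splits)
      then consider "label r i = 0" "label s i \<noteq> 0" | "label s i = 0" "label r i \<noteq> 0"
        by metis
      then show ?thesis
      proof cases
        case 1
        then show ?thesis using neg[of r i] pos[of s i] i le r s by blast
      next
        case 2
        then show ?thesis using neg[of s i] pos[of r i] i le r s by blast
      qed
    qed
    then show ?thesis using q by metis
  qed
  \<comment> \<open>Passing to \<open>Suc p\<close> discharges the positivity of the grid size, so
    that the cells form a sequence over all naturals.\<close>
  then have "\<forall>p. \<exists>q r s. (\<forall>i<n. q i < Suc p) \<and>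
      (\<forall>i<n. (\<forall>j<n. q j \<le> r i j \<and> r i j \<le> q j + 1 \<and> q j \<le> s i j \<and> s i j \<le> q j + 1) \<and>
         f i (T (Suc p) (r i)) \<le> 0 \<and> 0 \<le> f i (T (Suc p) (s i)))"
    by blast
  then obtain q r s where *: "\<forall>p. (\<forall>i<n. q p i < Suc p) \<and>
      (\<forall>i<n. (\<forall>j<n. q p j \<le> r p i j \<and> r p i j \<le> q p j + 1 \<and> q p j \<le> s p i j \<and> s p i j \<le> q p j + 1) \<and>
         f i (T (Suc p) (r p i)) \<le> 0 \<and> 0 \<le> f i (T (Suc p) (s p i)))"
    by metis
  have q_box: "T (Suc p) (q p) i \<in> {lo i..hi i}" if "i < n" for p i
    using * that by (intro T_box) (auto simp: less_imp_le)
  then obtain \<rho> l where \<rho>: "strict_mono \<rho>"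
    and l: "\<And>i. i < n \<Longrightarrow> (\<lambda>k. T (Suc (\<rho> k)) (q (\<rho> k)) i) \<longlonglongrightarrow> l i"
    using bounded_real_seqs_convergent_subseq[of n "\<lambda>p. T (Suc p) (q p)" lo hi] by blast
  \<comment> \<open>All corners of a cell share the limit of its base corner, because the side in
    direction \<open>j\<close> has length \<open>(hi j - lo j) / Suc p\<close>.\<close>
  have near: "(\<lambda>k. T (Suc (\<rho> k)) (v (\<rho> k)) j) \<longlonglongrightarrow> l j"
    if j: "j < n" and v: "\<And>p. q p j \<le> v p j \<and> v p j \<le> q p j + 1" for v :: "nat \<Rightarrow> nat \<Rightarrow> nat" and j
  proof -
    have "(\<lambda>p. (hi j - lo j) * inverse (real (Suc p))) \<longlonglongrightarrow> (hi j - lo j) * 0"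
      by (intro tendsto_mult tendsto_const LIMSEQ_inverse_real_of_nat)
    then have lim0: "(\<lambda>p. (hi j - lo j) * inverse (real (Suc p))) \<longlonglongrightarrow> 0"
      by simp
    have "(\<lambda>p. T (Suc p) (v p) j - T (Suc p) (q p) j) \<longlonglongrightarrow> 0"
    proof (rule Lim_null_comparison[OF _ lim0])
      show "\<forall>\<^sub>F p in sequentially.
          norm (T (Suc p) (v p) j - T (Suc p) (q p) j) \<le> (hi j - lo j) * inverse (real (Suc p))"
      proof (rule always_eventually, rule allI)
        fix p
        have "T (Suc p) (v p) j - T (Suc p) (q p) j
            = (hi j - lo j) * ((real (v p j) - real (q p j)) / real (Suc p))"
          unfolding T_def by (simp add: algebra_simps diff_divide_distrib)
        moreover have "\<bar>real (v p j) - real (q p j)\<bar> \<le> 1"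
          using v[of p] by linarith
        then have "\<bar>(real (v p j) - real (q p j)) / real (Suc p)\<bar> \<le> inverse (real (Suc p))"
          by (simp add: abs_divide divide_simps)
        ultimately show "norm (T (Suc p) (v p) j - T (Suc p) (q p) j) \<le> (hi j - lo j) * inverse (real (Suc p))"
          using box[OF j] unfolding real_norm_def by (simp only: abs_mult abs_of_nonneg diff_ge_0_iff_ge mult_left_mono)
      qed
    qed
    from tendsto_add[OF LIMSEQ_subseq_LIMSEQ[OF this \<rho>] l[OF j]]
    show ?thesis by (simp add: o_def)
  qed
  have lims: "(\<lambda>k. f i (T (Suc (\<rho> k)) (r (\<rho> k) i))) \<longlonglongrightarrow> f i l"
    "(\<lambda>k. f i (T (Suc (\<rho> k)) (s (\<rho> k) i))) \<longlonglongrightarrow> f i l" if "i < n" for i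
    using * that by (intro cont[OF that] near[of _ "\<lambda>p. r p i"] near[of _ "\<lambda>p. s p i"]; blast)+
  show thesis
  proof (rule that)
    fix i assume i: "i < n"
    show "l i \<in> {lo i..hi i}"
      by (rule closed_sequentially[OF _ _ l[OF i]]) (use q_box[OF i] in auto)
    show "f i l = 0"
    proof (rule antisym)
      show "f i l \<le> 0"
        by (rule LIMSEQ_le_const2[OF lims(1)[OF i]]) (use * i in blast)
      show "0 \<le> f i l"
        by (rule LIMSEQ_le_const[OF lims(2)[OF i]]) (use * i in blast)
    qed
  qed
qed

section \<open>Vectors and matrices\<close>

lemma scalar_prod_self_eq_0_iff:
  fixes v :: "real vec"
  assumes "v \<in> carrier_vec n"
  shows "v \<bullet> v = 0 \<longleftrightarrow> v = 0\<^sub>v n"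
  using conjugate_square_eq_0_vec[OF assms] by (simp add: conjugate_vec_def scalar_prod_def)

lemma vnorm_power2: "(vnorm v)\<^sup>2 = v \<bullet> v"
  unfolding vnorm_def scalar_prod_def by (intro real_sqrt_pow2 sum_nonneg) simp

lemma vnorm_eq_L2: "v \<in> carrier_vec n \<Longrightarrow> vnorm v = L2_set (\<lambda>i. v $ i) {0..<n}"
  by (simp add: vnorm_def L2_set_def scalar_prod_def power2_eq_square)

lemma index_mult_mat_vec_sum:
  assumes "A \<in> carrier_mat nr nc" "v \<in> carrier_vec nc" "i < nr"
  shows "(A *\<^sub>v v) $ i = (\<Sum>j = 0..<nc. A $$ (i, j) * v $ j)"
  using assms by (auto simp: scalar_prod_def intro!: sum.cong)

text \<open>A nonzero determinant excludes the value \<open>None\<close>, and only then does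
  \<open>the\<close> denote an actual inverse.\<close>

lemma injective_mat_inverse:
  fixes A :: "'a :: field mat"
  assumes A: "A \<in> carrier_mat n n"
    and inj: "\<And>v. v \<in> carrier_vec n \<Longrightarrow> A *\<^sub>v v = 0\<^sub>v n \<Longrightarrow> v = 0\<^sub>v n"
  shows "the (mat_inverse A) \<in> carrier_mat n n" "A * the (mat_inverse A) = 1\<^sub>m n"
proof -
  have "det A \<noteq> 0"
    using inj unfolding det_0_iff_vec_prod_zero[OF A] by blast
  then have "mat_inverse A \<noteq> None"
    using det_non_zero_imp_unit[OF A, where b = "()"] mat_inverse(1)[OF A, where b = "()"] by metis
  then show "the (mat_inverse A) \<in> carrier_mat n n" "A * the (mat_inverse A) = 1\<^sub>m n"
    using mat_inverse(2)[OF A] by auto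
qed

lemma outer_mult_mat_vec:
  fixes w :: "'a :: comm_ring_1 vec"
  assumes "w \<in> carrier_vec n" "y \<in> carrier_vec n"
  shows "mat n n (\<lambda>(i, j). w $ i * w $ j) *\<^sub>v y = (w \<bullet> y) \<cdot>\<^sub>v w"
  using assms
  by (intro eq_vecI) (auto simp: scalar_prod_def sum_distrib_left sum_distrib_right mult_ac)

lemma spans_line_carrier:
  assumes "spans_line v (mat_kernel M)" "M \<in> carrier_mat nr nc"
  shows "v \<in> carrier_vec nc" "M *\<^sub>v v = 0\<^sub>v nr"
proof -
  have "v = 1 \<cdot>\<^sub>v v" by simp
  then have "v \<in> mat_kernel M"
    using assms(1) unfolding spans_line_def by blast
  then show "v \<in> carrier_vec nc" "M *\<^sub>v v = 0\<^sub>v nr"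
    using mat_kernelD[OF assms(2)] by auto
qed

text \<open>
  The Fredholm alternative for a one-dimensional cokernel: \<open>D D\<^sup>T + w w\<^sup>T\<close> is injective, hence
  invertible, and it maps the preimage of any \<open>v \<bottom> w\<close> to a vector in the range of \<open>D\<close>.
\<close>

lemma orthogonal_to_cokernel_in_range:
  fixes D :: "real mat"
  assumes D: "D \<in> carrier_mat n n"
    and w: "spans_line w (mat_kernel (transpose_mat D))"
    and v: "v \<in> carrier_vec n" "w \<bullet> v = 0"
  obtains y where "y \<in> carrier_vec n" "D *\<^sub>v y = v"
proof -
  have DT: "transpose_mat D \<in> carrier_mat n n" using D by simp
  have wc: "w \<in> carrier_vec n" and wk: "transpose_mat D *\<^sub>v w = 0\<^sub>v n"
    using spans_line_carrier[OF w DT] by auto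
  define M where "M = D * transpose_mat D + mat n n (\<lambda>(i, j). w $ i * w $ j)"
  have M: "M \<in> carrier_mat n n" unfolding M_def using D by auto
  have M_mult: "M *\<^sub>v y = D *\<^sub>v (transpose_mat D *\<^sub>v y) + (w \<bullet> y) \<cdot>\<^sub>v w" if y: "y \<in> carrier_vec n" for y
    unfolding M_def using D DT wc y
    by (simp add: add_mult_distrib_mat_vec[where nr = n and nc = n] outer_mult_mat_vec
        assoc_mult_mat_vec[of D n n "transpose_mat D" n])
  have y_M: "y \<bullet> (M *\<^sub>v y) = (transpose_mat D *\<^sub>v y) \<bullet> (transpose_mat D *\<^sub>v y) + (w \<bullet> y)\<^sup>2"
    if y: "y \<in> carrier_vec n" for y
  proof -
    have c: "transpose_mat D *\<^sub>v y \<in> carrier_vec n" using DT y by auto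
    have "y \<bullet> (M *\<^sub>v y) = y \<bullet> (D *\<^sub>v (transpose_mat D *\<^sub>v y)) + y \<bullet> ((w \<bullet> y) \<cdot>\<^sub>v w)"
      unfolding M_mult[OF y] using D c wc y by (intro scalar_prod_add_distrib) auto
    also have "y \<bullet> (D *\<^sub>v (transpose_mat D *\<^sub>v y)) = (transpose_mat D *\<^sub>v y) \<bullet> (transpose_mat D *\<^sub>v y)"
      by (rule transpose_vec_mult_scalar[OF D c y, symmetric])
    also have "y \<bullet> ((w \<bullet> y) \<cdot>\<^sub>v w) = (w \<bullet> y)\<^sup>2"
      using wc y comm_scalar_prod[OF y wc] by (simp add: power2_eq_square)
    finally show ?thesis .
  qed
  \<comment> \<open>By \<open>y_M\<close> the form is a sum of two squares, so both vanish:
    \<open>y\<close> lies in the kernel of the transpose, hence on the line of \<open>w\<close>, and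
    is orthogonal to \<open>w\<close>.\<close>
  have inj: "y = 0\<^sub>v n" if y: "y \<in> carrier_vec n" and My: "M *\<^sub>v y = 0\<^sub>v n" for y
  proof -
    have c: "transpose_mat D *\<^sub>v y \<in> carrier_vec n" using DT y by auto
    have "0 \<le> (transpose_mat D *\<^sub>v y) \<bullet> (transpose_mat D *\<^sub>v y)"
      unfolding scalar_prod_def by (intro sum_nonneg) simp
    moreover have "(transpose_mat D *\<^sub>v y) \<bullet> (transpose_mat D *\<^sub>v y) + (w \<bullet> y)\<^sup>2 = 0"
      using y_M[OF y] My y by simp
    ultimately have "(transpose_mat D *\<^sub>v y) \<bullet> (transpose_mat D *\<^sub>v y) = 0" "w \<bullet> y = 0"
      by (smt (verit) zero_le_power2 power2_eq_iff_nonneg power_zero_numeral zero_eq_power2)+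
    then have "y \<in> mat_kernel (transpose_mat D)"
      using scalar_prod_self_eq_0_iff[OF c] mat_kernelI[OF DT y] by simp
    then obtain k where "y = k \<cdot>\<^sub>v w"
      using w unfolding spans_line_def by blast
    then have "y \<bullet> y = k * (w \<bullet> y)"
      using wc y by simp
    then show ?thesis
      using \<open>w \<bullet> y = 0\<close> scalar_prod_self_eq_0_iff[OF y] by simp
  qed
  define y where "y = the (mat_inverse M) *\<^sub>v v"
  have y: "y \<in> carrier_vec n" and My: "M *\<^sub>v y = v"
    unfolding y_def using injective_mat_inverse[OF M inj] v M
    by (auto simp: assoc_mult_mat_vec[symmetric, of M n n _ n])
  define x where "x = transpose_mat D *\<^sub>v y"
  have x: "x \<in> carrier_vec n" unfolding x_def using DT y by auto
  \<comment> \<open>Pairing v = D x + (w . y) w with \<open>w\<close> kills the first term and, by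
    hypothesis, the left-hand side. What remains shows that the rank-one part contributes nothing,
    so D x = v.\<close>
  have "w \<bullet> (D *\<^sub>v x) = 0"
    using transpose_vec_mult_scalar[OF D x wc] wk x by simp
  moreover have v_eq: "v = D *\<^sub>v x + (w \<bullet> y) \<cdot>\<^sub>v w"
    using My M_mult[OF y] by (simp add: x_def)
  then have "w \<bullet> v = w \<bullet> (D *\<^sub>v x) + w \<bullet> ((w \<bullet> y) \<cdot>\<^sub>v w)"
    using scalar_prod_add_distrib[OF wc, of "D *\<^sub>v x" "(w \<bullet> y) \<cdot>\<^sub>v w"] D x wc by auto
  ultimately have "(w \<bullet> y) * (w \<bullet> w) = 0"
    using v(2) wc by simp
  then have "(w \<bullet> y) \<cdot>\<^sub>v w = 0\<^sub>v n"
    using scalar_prod_self_eq_0_iff[OF wc] wc by auto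
  then have "D *\<^sub>v x = v"
    using v_eq D x by simp
  with x show thesis by (rule that)
qed

text \<open>\<open>THE\<close> requires uniqueness: the difference of two candidates lies on the
  line and is orthogonal to the line, hence to itself. For \<open>u\<close> zero the quotient is 0
  by convention, and the formula still gives the projection onto the zero space.\<close>

lemma orth_proj_line:
  fixes u :: "real vec"
  assumes u: "u \<in> carrier_vec n" and v: "v \<in> carrier_vec n" and K: "spans_line u K"
  shows "orth_proj K v = (v \<bullet> u / (u \<bullet> u)) \<cdot>\<^sub>v u"
  unfolding orth_proj_def
proof (rule the_equality)
  let ?p = "(v \<bullet> u / (u \<bullet> u)) \<cdot>\<^sub>v u"
  have K': "z \<in> K \<longleftrightarrow> (\<exists>c. z = c \<cdot>\<^sub>v u)" for z
    using K by (auto simp: spans_line_def)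
  have "v \<bullet> u - v \<bullet> u / (u \<bullet> u) * (u \<bullet> u) = 0"
    using scalar_prod_self_eq_0_iff[OF u] v by (cases "u \<bullet> u = 0") auto
  then have orth: "(v - ?p) \<bullet> u = 0"
    using u v by (simp add: minus_scalar_prod_distrib[of _ n])
  show *: "?p \<in> K \<and> (\<forall>z\<in>K. (v - ?p) \<bullet> z = 0)"
    using orth u v by (auto simp: K')
  fix q assume q: "q \<in> K \<and> (\<forall>z\<in>K. (v - q) \<bullet> z = 0)"
  then obtain c where c: "q = c \<cdot>\<^sub>v u" by (auto simp: K')
  have qc: "q \<in> carrier_vec n" and pc: "?p \<in> carrier_vec n" using u c by auto
  have "?p - q = (v \<bullet> u / (u \<bullet> u) - c) \<cdot>\<^sub>v u"
    unfolding c using u by (intro eq_vecI) (auto simp: algebra_simps)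
  then have "?p - q \<in> K" by (auto simp: K')
  then have "(v - q) \<bullet> (?p - q) = 0" "(v - ?p) \<bullet> (?p - q) = 0"
    using q * by auto
  moreover have "?p - q = (v - q) - (v - ?p)"
    using qc pc v by (intro eq_vecI) auto
  then have "(?p - q) \<bullet> (?p - q) = (v - q) \<bullet> (?p - q) - (v - ?p) \<bullet> (?p - q)"
    using qc pc v by (metis minus_carrier_vec minus_scalar_prod_distrib)
  ultimately have "?p - q = 0\<^sub>v n"
    using scalar_prod_self_eq_0_iff[of "?p - q" n] qc pc by simp
  then have "(?p - q) $ i = 0" if "i < n" for i using that by simp
  then show "q = ?p"
    using qc pc by (intro eq_vecI) auto
qed

text \<open>Turns the group-theoretic sum in \<open>Dmat\<close> into ordinary real sums of entries.
  Both claims are proved in one induction, since reading an entry of a sum needs the dimensions of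
  the partial sum.\<close>

lemma finsum_module_mat:
  assumes "finite F" "f \<in> F \<rightarrow> carrier_mat nr nc"
  shows finsum_module_mat_carrier: "finsum (module_mat TYPE('a::comm_ring_1) nr nc) f F \<in> carrier_mat nr nc"
    and index_finsum_module_mat: "\<And>i j. i < nr \<Longrightarrow> j < nc \<Longrightarrow>
      finsum (module_mat TYPE('a) nr nc) f F $$ (i, j) = (\<Sum>k\<in>F. f k $$ (i, j))"
proof -
  interpret M: abelian_group "module_mat TYPE('a) nr nc" by (rule abelian_group_mat)
  have "finsum (module_mat TYPE('a) nr nc) f F \<in> carrier_mat nr nc \<and> (\<forall>i<nr. \<forall>j<nc.
      finsum (module_mat TYPE('a) nr nc) f F $$ (i, j) = (\<Sum>k\<in>F. f k $$ (i, j)))"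
    using assms
  proof (induction F rule: finite_induct)
    case empty
    then show ?case by (simp add: module_mat_simps)
  next
    case (insert k F)
    have "finsum (module_mat TYPE('a) nr nc) f (insert k F) = f k + finsum (module_mat TYPE('a) nr nc) f F"
      using insert.hyps insert.prems
      by (subst M.finsum_insert) (auto simp: module_mat_simps)
    then show ?case using insert by auto
  qed
  then show "finsum (module_mat TYPE('a) nr nc) f F \<in> carrier_mat nr nc"
    "\<And>i j. i < nr \<Longrightarrow> j < nc \<Longrightarrow>
      finsum (module_mat TYPE('a) nr nc) f F $$ (i, j) = (\<Sum>k\<in>F. f k $$ (i, j))"
    by blast+
qed

lemma scalar_prod_finsum_vec:
  fixes f :: "'b \<Rightarrow> 'a :: comm_ring_1 vec"
  assumes "finite F" "f \<in> F \<rightarrow> carrier_vec n"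
  shows "w \<bullet> finsum_vec TYPE('a) n f F = (\<Sum>k\<in>F. w \<bullet> f k)"
proof -
  have "w \<bullet> finsum_vec TYPE('a) n f F = (\<Sum>i = 0..<n. \<Sum>k\<in>F. w $ i * f k $ i)"
    using finsum_vec_closed[OF assms(2)] assms
    by (simp add: scalar_prod_def index_finsum_vec sum_distrib_left)
  also have "\<dots> = (\<Sum>k\<in>F. \<Sum>i = 0..<n. w $ i * f k $ i)"
    by (rule sum.swap)
  also have "\<dots> = (\<Sum>k\<in>F. w \<bullet> f k)"
    using assms(2) by (intro sum.cong refl) (auto simp: scalar_prod_def Pi_iff)
  finally show ?thesis .
qed

text \<open>The entrywise form fixes the dimension by construction and reduces every linearity
  argument to manipulation of real sums; the index set may consist of pairs.\<close>

definition lincomb_vec :: "nat \<Rightarrow> 'i set \<Rightarrow> ('i \<Rightarrow> real) \<Rightarrow> ('i \<Rightarrow> real vec) \<Rightarrow> real vec" where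
  "lincomb_vec n I c v = vec n (\<lambda>j. \<Sum>i\<in>I. c i * v i $ j)"

lemma lincomb_vec_carrier [simp]: "lincomb_vec n I c v \<in> carrier_vec n"
  by (simp add: lincomb_vec_def)

lemma mult_mat_lincomb_vec:
  assumes "A \<in> carrier_mat nr nc" "\<And>i. i \<in> I \<Longrightarrow> v i \<in> carrier_vec nc"
  shows "A *\<^sub>v lincomb_vec nc I c v = lincomb_vec nr I c (\<lambda>i. A *\<^sub>v v i)"
proof (rule eq_vecI)
  fix k assume "k < dim_vec (lincomb_vec nr I c (\<lambda>i. A *\<^sub>v v i))"
  then have k: "k < nr" by (simp add: lincomb_vec_def)
  have "(A *\<^sub>v lincomb_vec nc I c v) $ k = (\<Sum>j = 0..<nc. A $$ (k, j) * (\<Sum>i\<in>I. c i * v i $ j))"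
    by (subst index_mult_mat_vec_sum[OF assms(1) _ k]) (simp_all add: lincomb_vec_def)
  also have "\<dots> = (\<Sum>i\<in>I. c i * (\<Sum>j = 0..<nc. A $$ (k, j) * v i $ j))"
    by (simp add: sum_distrib_left mult_ac sum.swap[of _ _ I])
  also have "\<dots> = lincomb_vec nr I c (\<lambda>i. A *\<^sub>v v i) $ k"
    using k by (simp add: lincomb_vec_def index_mult_mat_vec_sum[OF assms(1) assms(2) k] cong: sum.cong)
  finally show "(A *\<^sub>v lincomb_vec nc I c v) $ k = lincomb_vec nr I c (\<lambda>i. A *\<^sub>v v i) $ k" .
qed (use assms in \<open>simp add: lincomb_vec_def\<close>)

lemma lincomb_vec_scalar_prod:
  assumes "u \<in> carrier_vec n"
  shows "lincomb_vec n I c v \<bullet> u = (\<Sum>i\<in>I. c i * (v i \<bullet> u))"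
  using assms
  by (simp add: lincomb_vec_def scalar_prod_def sum_distrib_left sum_distrib_right mult_ac sum.swap[of _ _ I])

lemma scalar_prod_lincomb_vec:
  assumes "\<And>i. i \<in> I \<Longrightarrow> v i \<in> carrier_vec n"
  shows "u \<bullet> lincomb_vec n I c v = (\<Sum>i\<in>I. c i * (u \<bullet> v i))"
proof -
  have "u \<bullet> lincomb_vec n I c v = (\<Sum>i\<in>I. c i * (\<Sum>j = 0..<n. u $ j * v i $ j))"
    by (simp add: lincomb_vec_def scalar_prod_def sum_distrib_left sum_distrib_right mult_ac sum.swap[of _ _ I])
  also have "\<dots> = (\<Sum>i\<in>I. c i * (u \<bullet> v i))"
    using carrier_vecD[OF assms] by (intro sum.cong refl) (simp add: scalar_prod_def)
  finally show ?thesis .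
qed

lemma index_lincomb_vec: "j < n \<Longrightarrow> lincomb_vec n I c v $ j = (\<Sum>i\<in>I. c i * v i $ j)"
  by (simp add: lincomb_vec_def)

lemma abs_index_le_vnorm:
  assumes "v \<in> carrier_vec n" "i < n"
  shows "\<bar>v $ i\<bar> \<le> vnorm v"
proof -
  have "(v $ i)\<^sup>2 \<le> (\<Sum>j = 0..<n. (v $ j)\<^sup>2)"
    using assms(2) by (intro member_le_sum) auto
  then have "sqrt ((v $ i)\<^sup>2) \<le> sqrt (\<Sum>j = 0..<n. (v $ j)\<^sup>2)"
    by (rule real_sqrt_le_mono)
  then show ?thesis
    by (simp add: vnorm_eq_L2[OF assms(1)] L2_set_def)
qed

lemma vnorm_le_sum_abs: "v \<in> carrier_vec n \<Longrightarrow> vnorm v \<le> (\<Sum>i = 0..<n. \<bar>v $ i\<bar>)"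
  unfolding vnorm_eq_L2 by (rule L2_set_le_sum_abs)

lemma vnorm_le_supnorm: "finite T \<Longrightarrow> t \<in> T \<Longrightarrow> vnorm (\<phi> t) \<le> supnorm T \<phi>"
  unfolding supnorm_def by (intro Max_ge) auto

lemma supnorm_le_iff:
  "finite T \<Longrightarrow> T \<noteq> {} \<Longrightarrow> supnorm T \<phi> \<le> r \<longleftrightarrow> (\<forall>t\<in>T. vnorm (\<phi> t) \<le> r)"
  unfolding supnorm_def by (subst Max_le_iff) auto

section \<open>The linear boundary value problem at resonance\<close>

lemma companion_carrier [simp]: "companion n a t \<in> carrier_mat n n"
  by (simp add: companion_def)

lemma mult_mat_zero_vec: "A \<in> carrier_mat nr nc \<Longrightarrow> A *\<^sub>v 0\<^sub>v nc = (0\<^sub>v nr :: 'a :: semiring_0 vec)"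
  by (intro eq_vecI) auto

lemma diff_eq_iff_eq_add_vec:
  fixes p q z :: "real vec"
  assumes "p \<in> carrier_vec n" "q \<in> carrier_vec n" "z \<in> carrier_vec n"
  shows "p - q = z \<longleftrightarrow> p = q + z"
proof
  assume "p - q = z"
  then have "z = p - q" ..
  then show "p = q + z" using assms by (intro eq_vecI) auto
next
  assume "p = q + z"
  then show "p - q = z" using assms by (intro eq_vecI) auto
qed

lemma add_diff_cancel_right_vec:
  "p \<in> carrier_vec n \<Longrightarrow> q \<in> carrier_vec n \<Longrightarrow> z \<in> carrier_vec n \<Longrightarrow> (p + z) - (q + z) = p - (q :: real vec)"
  by (intro eq_vecI) auto

lemma bmat_carrier [simp]: "bmat n b k \<in> carrier_mat n n"
  by (simp add: bmat_def)

lemma Phi_carrier [simp]: "Phi n a t \<in> carrier_mat n n"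
  by (induction t) (simp_all add: mult_carrier_mat[of _ n n])

lemma dim_coefficient_mats [simp]:
  "dim_row (companion n a t) = n" "dim_row (bmat n b k) = n" "dim_row (Phi n a t) = n"
  by (rule carrier_matD(1)[OF companion_carrier] carrier_matD(1)[OF bmat_carrier] carrier_matD(1)[OF Phi_carrier])+

lemma companion_mult_vec_last:
  assumes "0 < n" "v \<in> carrier_vec n"
  shows "(companion n a t *\<^sub>v v) $ (n - 1) = - (\<Sum>j = 0..<n. a j t * v $ j)"
  using assms
  by (subst index_mult_mat_vec_sum[OF companion_carrier]) (auto simp: companion_def sum_negf)

lemma companion_mult_vec_shift:
  assumes "v \<in> carrier_vec n" "Suc i < n"
  shows "(companion n a t *\<^sub>v v) $ i = v $ Suc i"
proof -
  have "(companion n a t *\<^sub>v v) $ i = (\<Sum>j = 0..<n. companion n a t $$ (i, j) * v $ j)"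
    using assms by (intro index_mult_mat_vec_sum[OF companion_carrier]) auto
  also have "\<dots> = (\<Sum>j = 0..<n. if j = Suc i then v $ j else 0)"
    using assms by (intro sum.cong refl) (auto simp: companion_def)
  finally show ?thesis using assms by simp
qed

text \<open>The superdiagonal rows annihilate every component except the first; the last row then
  reads a_0(t) v_0 = 0.\<close>

lemma companion_injective:
  assumes a0: "a 0 t \<noteq> 0" and v: "v \<in> carrier_vec n" and 0: "companion n a t *\<^sub>v v = 0\<^sub>v n"
  shows "v = 0\<^sub>v n"
proof (cases "n = 0")
  case True
  then show ?thesis using v by auto
next
  case False
  have tail: "v $ Suc i = 0" if "Suc i < n" for i
    using companion_mult_vec_shift[OF v that, of a t] 0 that by simp
  have "(\<Sum>j = 0..<n. a j t * v $ j) = (\<Sum>j = 0..<n. if j = 0 then a 0 t * v $ 0 else 0)"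
  proof (intro sum.cong refl)
    fix j assume "j \<in> {0..<n}"
    then show "a j t * v $ j = (if j = 0 then a 0 t * v $ 0 else 0)"
      using tail by (cases j) auto
  qed
  then have "a 0 t * v $ 0 = 0"
    using companion_mult_vec_last[of n v a t] v 0 False by simp
  then have "v $ i = 0" if "i < n" for i
    using tail a0 that by (cases i) auto
  then show ?thesis using v by (intro eq_vecI) auto
qed

lemma Phi_injective:
  assumes "\<forall>i<t. a 0 i \<noteq> 0" "v \<in> carrier_vec n" "Phi n a t *\<^sub>v v = 0\<^sub>v n"
  shows "v = 0\<^sub>v n"
  using assms
proof (induction t)
  case (Suc t)
  have "companion n a t *\<^sub>v (Phi n a t *\<^sub>v v) = 0\<^sub>v n"
    using Suc.prems by (simp add: assoc_mult_mat_vec[of _ n n _ n])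
  moreover have "Phi n a t *\<^sub>v v \<in> carrier_vec n"
    using Suc.prems by (simp add: mult_mat_vec_carrier[of _ n n])
  ultimately have "Phi n a t *\<^sub>v v = 0\<^sub>v n"
    using Suc.prems companion_injective by blast
  then show ?case using Suc by simp
qed simp

lemma Dmat_carrier: "Dmat n N a b \<in> carrier_mat n n"
  unfolding Dmat_def by (intro finsum_module_mat_carrier) (auto simp: mult_carrier_mat[of _ n n])

text \<open>Identifies D v as the boundary value of the homogeneous solution that starts at
  \<open>v\<close>, which is how the kernel of D comes to describe resonance.\<close>

lemma Dmat_mult_vec:
  assumes v: "v \<in> carrier_vec n"
  shows "Dmat n N a b *\<^sub>v v = finsum_vec TYPE(real) n (\<lambda>k. bmat n b k *\<^sub>v (Phi n a k *\<^sub>v v)) {0..N}"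
proof (rule eq_vecI)
  have c: "(\<lambda>k. bmat n b k *\<^sub>v (Phi n a k *\<^sub>v v)) \<in> {0..N} \<rightarrow> carrier_vec n"
    by (auto intro!: mult_mat_vec_carrier[of _ n n] v)
  show "dim_vec (Dmat n N a b *\<^sub>v v) =
      dim_vec (finsum_vec TYPE(real) n (\<lambda>k. bmat n b k *\<^sub>v (Phi n a k *\<^sub>v v)) {0..N})"
    using finsum_vec_closed[OF c] Dmat_carrier[of n N a b] by simp
  fix i assume "i < dim_vec (finsum_vec TYPE(real) n (\<lambda>k. bmat n b k *\<^sub>v (Phi n a k *\<^sub>v v)) {0..N})"
  then have i: "i < n" using finsum_vec_closed[OF c] by simp
  have "(Dmat n N a b *\<^sub>v v) $ i = (\<Sum>j = 0..<n. \<Sum>k = 0..N. (bmat n b k * Phi n a k) $$ (i, j) * v $ j)"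
    unfolding index_mult_mat_vec_sum[OF Dmat_carrier v i] unfolding Dmat_def
    using i
    by (intro sum.cong refl) (simp add: index_finsum_module_mat mult_carrier_mat[of _ n n] sum_distrib_right)
  also have "\<dots> = (\<Sum>k = 0..N. (bmat n b k * Phi n a k *\<^sub>v v) $ i)"
    by (subst sum.swap) (simp add: index_mult_mat_vec_sum[OF mult_carrier_mat[OF bmat_carrier Phi_carrier] v i])
  also have "\<dots> = finsum_vec TYPE(real) n (\<lambda>k. bmat n b k *\<^sub>v (Phi n a k *\<^sub>v v)) {0..N} $ i"
    by (simp add: index_finsum_vec[OF _ i c] assoc_mult_mat_vec[OF bmat_carrier Phi_carrier v])
  finally show "(Dmat n N a b *\<^sub>v v) $ i =
      finsum_vec TYPE(real) n (\<lambda>k. bmat n b k *\<^sub>v (Phi n a k *\<^sub>v v)) {0..N} $ i" .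
qed

text \<open>The data of the linear theory. The last assumption guarantees that the normalising sum
  in \<open>Qop\<close> is nonzero.\<close>

locale resonant_problem =
  fixes n N :: nat and a :: "nat \<Rightarrow> nat \<Rightarrow> real" and b :: "nat \<Rightarrow> nat \<Rightarrow> nat \<Rightarrow> real" and u w :: "real vec"
  assumes n_pos: "0 < n"
    and a0: "\<And>t. t < N \<Longrightarrow> a 0 t \<noteq> 0"
    and u: "spans_line u (mat_kernel (Dmat n N a b))"
    and w: "spans_line w (mat_kernel (transpose_mat (Dmat n N a b)))"
    and Psi_n_nonzero: "\<exists>t<N. Psi_n n N a b w t \<noteq> 0"
begin

section \<open>Fundamental matrix and adjoint sequence\<close>

abbreviation "C \<equiv> companion n a"
abbreviation "B \<equiv> bmat n b"
abbreviation "\<Phi> \<equiv> Phi n a"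
abbreviation "D \<equiv> Dmat n N a b"
abbreviation "\<Psi> \<equiv> Psi n N a b w"
abbreviation "boundary x \<equiv> finsum_vec TYPE(real) n (\<lambda>k. B k *\<^sub>v x k) {0..N}"

lemma u_carrier [simp]: "u \<in> carrier_vec n" and D_u: "D *\<^sub>v u = 0\<^sub>v n"
  using spans_line_carrier[OF u Dmat_carrier] by auto

lemma w_carrier [simp]: "w \<in> carrier_vec n"
  using spans_line_carrier[OF w, of n n] Dmat_carrier by auto

lemma mult_vec_carrier [simp]:
  "v \<in> carrier_vec n \<Longrightarrow> C t *\<^sub>v v \<in> carrier_vec n"
  "v \<in> carrier_vec n \<Longrightarrow> B t *\<^sub>v v \<in> carrier_vec n"
  "v \<in> carrier_vec n \<Longrightarrow> \<Phi> t *\<^sub>v v \<in> carrier_vec n"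
  by (simp_all add: mult_mat_vec_carrier[of _ n n])

lemma Phi_Suc_mult_vec: "v \<in> carrier_vec n \<Longrightarrow> \<Phi> (Suc t) *\<^sub>v v = C t *\<^sub>v (\<Phi> t *\<^sub>v v)"
  by (simp add: assoc_mult_mat_vec[of _ n n _ n])

lemma Phi_inverse:
  assumes "t \<le> N"
  shows "the (mat_inverse (\<Phi> t)) \<in> carrier_mat n n" "\<Phi> t * the (mat_inverse (\<Phi> t)) = 1\<^sub>m n"
proof -
  have "v = 0\<^sub>v n" if "v \<in> carrier_vec n" "\<Phi> t *\<^sub>v v = 0\<^sub>v n" for v
    using Phi_injective[OF _ that] a0 assms by auto
  then show "the (mat_inverse (\<Phi> t)) \<in> carrier_mat n n" "\<Phi> t * the (mat_inverse (\<Phi> t)) = 1\<^sub>m n"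
    using injective_mat_inverse[OF Phi_carrier] by blast+
qed

lemma Psi_summand_carrier:
  "t < N \<Longrightarrow> (\<lambda>i. transpose_mat (B i * \<Phi> i * the (mat_inverse (\<Phi> (t + 1)))) *\<^sub>v w)
    \<in> {t + 1..N} \<rightarrow> carrier_vec n"
  using Phi_inverse[of "t + 1"]
  by (auto intro!: mult_mat_vec_carrier[of _ n n] mult_carrier_mat[of _ n n])

lemma Psi_carrier: "t < N \<Longrightarrow> \<Psi> t \<in> carrier_vec n"
  unfolding Psi_def by (rule finsum_vec_closed) (rule Psi_summand_carrier)

lemma Psi_nonzero: "(\<Sum>t = 0..<N. (vnorm (\<Psi> t))\<^sup>2) \<noteq> 0"
proof -
  obtain t where t: "t < N" "Psi_n n N a b w t \<noteq> 0" using Psi_n_nonzero by blast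
  then have "0 < vnorm (\<Psi> t)"
    using abs_index_le_vnorm[OF Psi_carrier, of t "n - 1"] n_pos by (simp add: Psi_n_def)
  then have "0 < (\<Sum>t = 0..<N. (vnorm (\<Psi> t))\<^sup>2)"
    using t(1) by (intro sum_pos2[of _ t]) auto
  then show ?thesis by simp
qed

text \<open>Adjoint form of the definition. The product of \<Phi>(k) with the inverse of \<Phi>(t+1)
  carries an impulse \<open>h\<close> that enters at time t + 1 to time k, so the right-hand side is
  the boundary value caused by this impulse, tested against \<open>w\<close>.\<close>

lemma Psi_scalar_prod:
  assumes t: "t < N" and h: "h \<in> carrier_vec n"
  shows "\<Psi> t \<bullet> h = (\<Sum>k = t + 1..N. w \<bullet> (B k *\<^sub>v (\<Phi> k *\<^sub>v (the (mat_inverse (\<Phi> (t + 1))) *\<^sub>v h))))"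
proof -
  let ?Y = "the (mat_inverse (\<Phi> (t + 1)))"
  have Y: "?Y \<in> carrier_mat n n" using Phi_inverse[of "t + 1"] t by simp
  have BP: "B k * \<Phi> k \<in> carrier_mat n n" for k by (rule mult_carrier_mat[OF bmat_carrier Phi_carrier])
  have "\<Psi> t \<bullet> h = h \<bullet> \<Psi> t" using Psi_carrier[OF t] h by (rule comm_scalar_prod)
  also have "\<dots> = (\<Sum>k = t + 1..N. h \<bullet> (transpose_mat (B k * \<Phi> k * ?Y) *\<^sub>v w))"
    unfolding Psi_def using Psi_summand_carrier[OF t] by (subst scalar_prod_finsum_vec) simp_all
  also have "\<dots> = (\<Sum>k = t + 1..N. w \<bullet> (B k *\<^sub>v (\<Phi> k *\<^sub>v (?Y *\<^sub>v h))))"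
  proof (intro sum.cong refl)
    fix k
    have M: "B k * \<Phi> k * ?Y \<in> carrier_mat n n" by (rule mult_carrier_mat[OF BP Y])
    have "h \<bullet> (transpose_mat (B k * \<Phi> k * ?Y) *\<^sub>v w) = (transpose_mat (B k * \<Phi> k * ?Y) *\<^sub>v w) \<bullet> h"
      using M h by (intro comm_scalar_prod[of _ n] mult_mat_vec_carrier[of _ n n]) auto
    also have "\<dots> = w \<bullet> (B k * \<Phi> k * ?Y *\<^sub>v h)"
      by (rule transpose_vec_mult_scalar[OF M h w_carrier])
    also have "B k * \<Phi> k * ?Y *\<^sub>v h = B k *\<^sub>v (\<Phi> k *\<^sub>v (?Y *\<^sub>v h))"
      unfolding assoc_mult_mat_vec[OF BP Y h]
        assoc_mult_mat_vec[OF bmat_carrier Phi_carrier mult_mat_vec_carrier[OF Y h]] ..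
    finally show "h \<bullet> (transpose_mat (B k * \<Phi> k * ?Y) *\<^sub>v w) = w \<bullet> (B k *\<^sub>v (\<Phi> k *\<^sub>v (?Y *\<^sub>v h)))" .
  qed
  finally show ?thesis .
qed

text \<open>At time 0 the matrix \<Phi> is the identity, so P x = 0 forces the projection of
  \<open>x 0\<close> onto the line of \<open>u\<close> to vanish; conversely that projection
  determines P x.\<close>

lemma kerP_iff:
  "x \<in> kerP n N a b \<longleftrightarrow>
    x \<in> {0..N} \<rightarrow>\<^sub>E carrier_vec n \<and> boundary x = 0\<^sub>v n \<and> x 0 \<bullet> u = 0"
proof -
  have "Pop n N a b x = (\<lambda>t\<in>{0..N}. 0\<^sub>v n) \<longleftrightarrow> x 0 \<bullet> u = 0" if x: "x 0 \<in> carrier_vec n"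
  proof
    let ?p = "(x 0 \<bullet> u / (u \<bullet> u)) \<cdot>\<^sub>v u"
    have P: "Pop n N a b x = (\<lambda>t\<in>{0..N}. \<Phi> t *\<^sub>v ?p)"
      unfolding Pop_def orth_proj_line[OF u_carrier x u] ..
    {
      assume "Pop n N a b x = (\<lambda>t\<in>{0..N}. 0\<^sub>v n)"
      then have "Pop n N a b x 0 = 0\<^sub>v n" by simp
      then have "?p = 0\<^sub>v n" unfolding P by simp
      then have "?p \<bullet> u = 0" by simp
      then show "x 0 \<bullet> u = 0"
        using scalar_prod_self_eq_0_iff[OF u_carrier] x by (cases "u \<bullet> u = 0") auto
    next
      assume "x 0 \<bullet> u = 0"
      then have "?p = 0\<^sub>v n" by (intro eq_vecI) (simp_all add: carrier_vecD[OF u_carrier])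
      then show "Pop n N a b x = (\<lambda>t\<in>{0..N}. 0\<^sub>v n)"
        unfolding P by (simp add: mult_mat_zero_vec[OF Phi_carrier])
    }
  qed
  moreover have "x 0 \<in> carrier_vec n" if "x \<in> {0..N} \<rightarrow>\<^sub>E carrier_vec n"
    using that by auto
  ultimately show ?thesis
    by (auto simp: kerP_def Xspace_def)
qed

section \<open>Injectivity and range of L on ker P\<close>

lemma boundary_summand_carrier:
  "x \<in> {0..N} \<rightarrow>\<^sub>E carrier_vec n \<Longrightarrow> (\<lambda>k. B k *\<^sub>v x k) \<in> {0..N} \<rightarrow> carrier_vec n"
  by (intro Pi_I mult_vec_carrier) (erule PiE_mem)

lemma Lop_in_Zspace:
  "x \<in> {0..N} \<rightarrow>\<^sub>E carrier_vec n \<Longrightarrow> Lop n N a x \<in> Zspace n N"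
  unfolding Lop_def Zspace_def restrict_PiE_iff
  by (intro ballI minus_carrier_vec mult_vec_carrier) auto

lemma Lop_eq_iff:
  assumes x: "x \<in> {0..N} \<rightarrow>\<^sub>E carrier_vec n" and z: "z \<in> Zspace n N"
  shows "Lop n N a x = z \<longleftrightarrow> (\<forall>t<N. x (Suc t) = C t *\<^sub>v x t + z t)"
proof -
  have "Lop n N a x t = z t \<longleftrightarrow> x (Suc t) = C t *\<^sub>v x t + z t" if t: "t < N" for t
  proof -
    have c: "x (Suc t) \<in> carrier_vec n" "C t *\<^sub>v x t \<in> carrier_vec n" "z t \<in> carrier_vec n"
      using PiE_mem[OF x] z t by (auto simp: Zspace_def)
    show ?thesis using t diff_eq_iff_eq_add_vec[OF c] by (simp add: Lop_def)
  qed
  moreover have "Lop n N a x = z \<longleftrightarrow> (\<forall>t<N. Lop n N a x t = z t)"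
    using Lop_in_Zspace[OF x] z unfolding Zspace_def
    by (auto intro!: PiE_ext[where k = "{0..<N}" and s = "\<lambda>_. carrier_vec n"])
  ultimately show ?thesis by auto
qed

text \<open>Two preimages differ by a homogeneous solution \<Phi>(t) v. The boundary conditions give
  D v = 0, so \<open>v\<close> is a multiple of \<open>u\<close>; membership in ker P gives v . u =
  0, hence v = 0.\<close>

lemma Lop_inj_on_kerP: "inj_on (Lop n N a) (kerP n N a b)"
proof (rule inj_onI)
  fix x x' assume "x \<in> kerP n N a b" "x' \<in> kerP n N a b" and eq: "Lop n N a x = Lop n N a x'"
  then have x: "x \<in> {0..N} \<rightarrow>\<^sub>E carrier_vec n" "boundary x = 0\<^sub>v n" "x 0 \<bullet> u = 0"
    and x': "x' \<in> {0..N} \<rightarrow>\<^sub>E carrier_vec n" "boundary x' = 0\<^sub>v n" "x' 0 \<bullet> u = 0"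
    by (auto simp: kerP_iff)
  have c: "x t \<in> carrier_vec n" "x' t \<in> carrier_vec n" if "t \<le> N" for t
    using x(1) x'(1) that by auto
  define v where "v = x 0 - x' 0"
  have v: "v \<in> carrier_vec n" unfolding v_def using c[of 0] by (simp add: minus_carrier_vec)
  have step: "x (Suc t) = C t *\<^sub>v x t + Lop n N a x' t" "x' (Suc t) = C t *\<^sub>v x' t + Lop n N a x' t"
    if "t < N" for t
    using Lop_eq_iff[OF x(1) Lop_in_Zspace[OF x'(1)]] Lop_eq_iff[OF x'(1) Lop_in_Zspace[OF x'(1)]]
      eq that by auto
  have diff: "x t - x' t = \<Phi> t *\<^sub>v v" if "t \<le> N" for t
    using that
  proof (induction t)
    case 0
    show ?case using v by (simp add: v_def)
  next
    case (Suc t)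
    then have t: "t < N" and IH: "x t - x' t = \<Phi> t *\<^sub>v v" by auto
    have z: "Lop n N a x' t \<in> carrier_vec n"
      using Lop_in_Zspace[OF x'(1)] t by (auto simp: Zspace_def)
    have cc: "C t *\<^sub>v x t \<in> carrier_vec n" "C t *\<^sub>v x' t \<in> carrier_vec n"
      using c[of t] t by auto
    have "x (Suc t) - x' (Suc t) = C t *\<^sub>v x t - C t *\<^sub>v x' t"
      unfolding step[OF t] by (rule add_diff_cancel_right_vec[OF cc z])
    also have "\<dots> = C t *\<^sub>v (x t - x' t)"
      using mult_minus_distrib_mat_vec[OF companion_carrier, of "x t" n "x' t" a t] c[of t] t by simp
    finally show ?case unfolding IH using v by (simp add: Phi_Suc_mult_vec del: Phi.simps)
  qed
  have "D *\<^sub>v v = 0\<^sub>v n"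
  proof (rule eq_vecI)
    fix i assume "i < dim_vec (0\<^sub>v n)"
    then have i: "i < n" by simp
    have "(D *\<^sub>v v) $ i = (\<Sum>k = 0..N. (B k *\<^sub>v (\<Phi> k *\<^sub>v v)) $ i)"
      unfolding Dmat_mult_vec[OF v] using i v by (subst index_finsum_vec) auto
    also have "\<dots> = (\<Sum>k = 0..N. (B k *\<^sub>v x k) $ i - (B k *\<^sub>v x' k) $ i)"
    proof (intro sum.cong refl)
      fix k assume "k \<in> {0..N}"
      then have k: "k \<le> N" by simp
      show "(B k *\<^sub>v (\<Phi> k *\<^sub>v v)) $ i = (B k *\<^sub>v x k) $ i - (B k *\<^sub>v x' k) $ i"
        unfolding diff[OF k, symmetric] mult_minus_distrib_mat_vec[OF bmat_carrier c[OF k]]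
        using i c[OF k] by simp
    qed
    also have "\<dots> = boundary x $ i - boundary x' $ i"
      using i by (simp add: index_finsum_vec boundary_summand_carrier x(1) x'(1) sum_subtractf)
    finally show "(D *\<^sub>v v) $ i = 0\<^sub>v n $ i" using i x x' by simp
  qed (use Dmat_carrier[of n N a b] in simp)
  then have "v \<in> mat_kernel D" by (intro mat_kernelI[OF Dmat_carrier v])
  then obtain k where k: "v = k \<cdot>\<^sub>v u" using u by (auto simp: spans_line_def)
  have "v \<bullet> u = 0"
    unfolding v_def using minus_scalar_prod_distrib[of "x 0" n "x' 0" u] c[of 0] x(3) x'(3) by simp
  moreover have "v \<bullet> v = k * (v \<bullet> u)"
    using v by (subst (2) k) simp
  ultimately have "v = 0\<^sub>v n"
    using scalar_prod_self_eq_0_iff[OF v] by simp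
  then have "x t - x' t = 0\<^sub>v n" if "t \<le> N" for t
    unfolding diff[OF that] by (intro eq_vecI) (simp_all add: scalar_prod_def)
  then have "x t = x' t" if "t \<le> N" for t
    using diff_eq_iff_eq_add_vec[OF c[OF that], of "0\<^sub>v n"] c(2)[OF that] that by simp
  then show "x = x'" by (intro PiE_ext[OF x(1) x'(1)]) auto
qed

text \<open>Variation of constants: x(t) = \<Phi>(t) (v + q(t)), where \<open>q\<close> accumulates
  the terms \<open>Y i *\<^sub>v z i\<close> with \<open>Y i\<close> inverse to \<Phi>(i+1). The
  boundary conditions become D v = -r, and the orthogonality of \<open>z\<close> to \<Psi> is
  exactly w . r = 0, the Fredholm condition for this equation.\<close>

lemma Lop_surj:
  assumes z: "z \<in> Zspace n N" and Psi_z: "(\<Sum>t = 0..<N. \<Psi> t \<bullet> z t) = 0"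
  shows "z \<in> Lop n N a ` kerP n N a b"
proof -
  define Y where "Y t = the (mat_inverse (\<Phi> (t + 1)))" for t
  have Y: "Y t \<in> carrier_mat n n" "\<Phi> (Suc t) * Y t = 1\<^sub>m n" if "t < N" for t
    using Phi_inverse[of "t + 1"] that unfolding Y_def by auto
  have zc: "z t \<in> carrier_vec n" if "t < N" for t
    using z that by (auto simp: Zspace_def)
  have Yz: "Y t *\<^sub>v z t \<in> carrier_vec n" if "t < N" for t
    using mult_mat_vec_carrier[OF Y(1) zc] that by auto
  define q where "q t = finsum_vec TYPE(real) n (\<lambda>i. Y i *\<^sub>v z i) {0..<t}" for t
  have q: "q t \<in> carrier_vec n" if "t \<le> N" for t
    unfolding q_def using that by (intro finsum_vec_closed) (auto intro: Yz)
  have q_Suc: "q (Suc t) = q t + Y t *\<^sub>v z t" if "t < N" for t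
  proof -
    have "q (Suc t) = Y t *\<^sub>v z t + q t"
      unfolding q_def atLeast0_lessThan_Suc using that by (intro finsum_vec_insert) (auto intro: Yz)
    also have "\<dots> = q t + Y t *\<^sub>v z t"
      by (rule comm_add_vec[OF Yz q]) (use that in auto)
    finally show ?thesis .
  qed
  \<comment> \<open>The boundary value of the particular solution that starts at 0; D v has to
    cancel it.\<close>
  define r where "r = boundary (\<lambda>k. \<Phi> k *\<^sub>v q k)"
  have r: "r \<in> carrier_vec n"
    unfolding r_def by (intro finsum_vec_closed Pi_I mult_vec_carrier) (simp add: q)
  have "w \<bullet> r = (\<Sum>k = 0..N. \<Sum>t = 0..<k. w \<bullet> (B k *\<^sub>v (\<Phi> k *\<^sub>v (Y t *\<^sub>v z t))))"
    unfolding r_def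
  proof (subst scalar_prod_finsum_vec, simp, use q in force, intro sum.cong refl)
    fix k assume "k \<in> {0..N}"
    then have k: "k \<le> N" by simp
    have BP: "B k * \<Phi> k \<in> carrier_mat n n" by (rule mult_carrier_mat[OF bmat_carrier Phi_carrier])
    have BPt: "transpose_mat (B k * \<Phi> k) *\<^sub>v w \<in> carrier_vec n"
      using BP by (intro mult_mat_vec_carrier[of _ n n]) auto
    have adj: "w \<bullet> (B k *\<^sub>v (\<Phi> k *\<^sub>v v)) = (transpose_mat (B k * \<Phi> k) *\<^sub>v w) \<bullet> v"
      if v: "v \<in> carrier_vec n" for v
      using transpose_vec_mult_scalar[OF BP v w_carrier] assoc_mult_mat_vec[OF bmat_carrier Phi_carrier v]
      by simp
    have "(transpose_mat (B k * \<Phi> k) *\<^sub>v w) \<bullet> q k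
        = (\<Sum>t = 0..<k. (transpose_mat (B k * \<Phi> k) *\<^sub>v w) \<bullet> (Y t *\<^sub>v z t))"
      unfolding q_def using k by (intro scalar_prod_finsum_vec) (auto intro: Yz)
    then show "w \<bullet> (B k *\<^sub>v (\<Phi> k *\<^sub>v q k)) = (\<Sum>t = 0..<k. w \<bullet> (B k *\<^sub>v (\<Phi> k *\<^sub>v (Y t *\<^sub>v z t))))"
      using k by (simp add: adj q Yz)
  qed
  \<comment> \<open>Interchange of summation over the triangle t < k \<le> N, which is what puts the
    lower limit t + 1 into \<open>Psi\<close>.\<close>
  also have "\<dots> = (\<Sum>t = 0..<N. \<Sum>k = t + 1..N. w \<bullet> (B k *\<^sub>v (\<Phi> k *\<^sub>v (Y t *\<^sub>v z t))))"
    unfolding sum.Sigma[OF finite_atLeastAtMost ballI[OF finite_atLeastLessThan]]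
      sum.Sigma[OF finite_atLeastLessThan ballI[OF finite_atLeastAtMost]]
    by (rule sum.reindex_bij_witness[of _ prod.swap prod.swap]) auto
  also have "\<dots> = (\<Sum>t = 0..<N. \<Psi> t \<bullet> z t)"
    unfolding Y_def by (intro sum.cong refl) (simp add: Psi_scalar_prod zc)
  finally have w_r: "w \<bullet> r = 0" using Psi_z by simp
  then have "w \<bullet> (- r) = 0" using r by simp
  then obtain y where y: "y \<in> carrier_vec n" "D *\<^sub>v y = - r"
    using orthogonal_to_cokernel_in_range[OF Dmat_carrier w, of "- r"] r by auto
  \<comment> \<open>Removing the component along \<open>u\<close> leaves D y unchanged, because D u
    = 0, and moves the solution into ker P.\<close>
  define v where "v = y - (y \<bullet> u / (u \<bullet> u)) \<cdot>\<^sub>v u"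
  have v: "v \<in> carrier_vec n" unfolding v_def using y by auto
  have "D *\<^sub>v v = - r - (y \<bullet> u / (u \<bullet> u)) \<cdot>\<^sub>v 0\<^sub>v n"
    unfolding v_def using y D_u
    by (simp add: mult_minus_distrib_mat_vec[OF Dmat_carrier] mult_mat_vec[OF Dmat_carrier])
  also have "\<dots> = - r"
    using r by (intro eq_vecI) auto
  finally have D_v: "D *\<^sub>v v = - r" .
  have "v \<bullet> u = 0"
    unfolding v_def using scalar_prod_self_eq_0_iff[OF u_carrier] y
    by (cases "u \<bullet> u = 0") (auto simp: minus_scalar_prod_distrib[of _ n])
  define x where "x = (\<lambda>t\<in>{0..N}. \<Phi> t *\<^sub>v (v + q t))"
  have x: "x \<in> {0..N} \<rightarrow>\<^sub>E carrier_vec n"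
    unfolding x_def using v q by auto
  have "boundary x = D *\<^sub>v v + r"
  proof (rule eq_vecI)
    fix i assume "i < dim_vec (D *\<^sub>v v + r)"
    then have i: "i < n" using r by simp
    have "boundary x $ i = (\<Sum>k = 0..N. (B k *\<^sub>v x k) $ i)"
      by (rule index_finsum_vec[OF _ i boundary_summand_carrier[OF x]]) simp
    also have "\<dots> = (\<Sum>k = 0..N. (B k *\<^sub>v (\<Phi> k *\<^sub>v v)) $ i + (B k *\<^sub>v (\<Phi> k *\<^sub>v q k)) $ i)"
    proof (intro sum.cong refl)
      fix k assume k: "k \<in> {0..N}"
      then have qk: "q k \<in> carrier_vec n" by (simp add: q)
      have "B k *\<^sub>v x k = B k *\<^sub>v (\<Phi> k *\<^sub>v v) + B k *\<^sub>v (\<Phi> k *\<^sub>v q k)"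
        using k v qk by (simp add: x_def mult_add_distrib_mat_vec[OF Phi_carrier]
            mult_add_distrib_mat_vec[OF bmat_carrier])
      then show "(B k *\<^sub>v x k) $ i = (B k *\<^sub>v (\<Phi> k *\<^sub>v v)) $ i + (B k *\<^sub>v (\<Phi> k *\<^sub>v q k)) $ i"
        using i qk by simp
    qed
    also have "\<dots> = (D *\<^sub>v v + r) $ i"
      unfolding Dmat_mult_vec[OF v] r_def sum.distrib using i v q
      by (subst index_add_vec) (auto simp: index_finsum_vec carrier_vecD[OF finsum_vec_closed])
    finally show "boundary x $ i = (D *\<^sub>v v + r) $ i" .
  next
    show "dim_vec (boundary x) = dim_vec (D *\<^sub>v v + r)"
      using carrier_vecD[OF finsum_vec_closed[OF boundary_summand_carrier[OF x]]] r by simp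
  qed
  then have "boundary x = 0\<^sub>v n"
    unfolding D_v using r by simp
  moreover have "x 0 = v"
    using v by (simp add: x_def q_def finsum_vec_empty)
  ultimately have "x \<in> kerP n N a b"
    using x \<open>v \<bullet> u = 0\<close> by (simp add: kerP_iff)
  moreover have "Lop n N a x = z"
    unfolding Lop_eq_iff[OF x z]
  proof (intro allI impI)
    fix t assume t: "t < N"
    have "\<Phi> (Suc t) *\<^sub>v (Y t *\<^sub>v z t) = z t"
      using assoc_mult_mat_vec[OF Phi_carrier Y(1)[OF t] zc[OF t]] Y(2)[OF t] zc[OF t] by (metis one_mult_mat_vec)
    note \<Phi>Yz = this
    have "v + q (Suc t) = (v + q t) + Y t *\<^sub>v z t"
      unfolding q_Suc[OF t] using v q[of t] Yz[OF t] t by (simp add: assoc_add_vec[of _ n])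
    then have "\<Phi> (Suc t) *\<^sub>v (v + q (Suc t)) = \<Phi> (Suc t) *\<^sub>v ((v + q t) + Y t *\<^sub>v z t)"
      by (simp only:)
    also have "\<dots> = \<Phi> (Suc t) *\<^sub>v (v + q t) + \<Phi> (Suc t) *\<^sub>v (Y t *\<^sub>v z t)"
      using v q[of t] Yz[OF t] t by (intro mult_add_distrib_mat_vec[OF Phi_carrier]) auto
    also have "\<dots> = \<Phi> (Suc t) *\<^sub>v (v + q t) + z t"
      by (simp only: \<Phi>Yz)
    finally have "\<Phi> (Suc t) *\<^sub>v (v + q (Suc t)) = \<Phi> (Suc t) *\<^sub>v (v + q t) + z t" .
    then show "x (Suc t) = C t *\<^sub>v x t + z t"
      using t v q[of t] by (simp add: x_def Phi_Suc_mult_vec del: Phi.simps)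
  qed
  ultimately show ?thesis by blast
qed

section \<open>Linearity of M_p (I - Q)\<close>

definition residual :: "(nat \<Rightarrow> real vec) \<Rightarrow> nat \<Rightarrow> real vec" where
  "residual h = (\<lambda>t\<in>{0..<N}. h t - Qop n N a b w h t)"

lemma Zspace_mem: "h \<in> Zspace n N \<Longrightarrow> t < N \<Longrightarrow> h t \<in> carrier_vec n"
  by (auto simp: Zspace_def)

lemma N_pos: "0 < N"
  using Psi_nonzero by (cases N) auto

lemma Qop_carrier: "t < N \<Longrightarrow> Qop n N a b w h t \<in> carrier_vec n"
  by (simp add: Qop_def Psi_carrier)

lemma residual_in_Zspace: "h \<in> Zspace n N \<Longrightarrow> residual h \<in> Zspace n N"
  unfolding residual_def Zspace_def restrict_PiE_iff
  by (intro ballI minus_carrier_vec) (auto simp: Qop_carrier)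

lemma index_residual:
  assumes "h \<in> Zspace n N" "t < N" "j < n"
  shows "residual h t $ j = h t $ j
    - inverse (\<Sum>j = 0..<N. (vnorm (\<Psi> j))\<^sup>2) * (\<Sum>i = 0..<N. \<Psi> i \<bullet> h i) * \<Psi> t $ j"
  using assms Psi_carrier[of t] by (simp add: residual_def Qop_def)

text \<open>The normalisation in \<open>Qop\<close> makes h and Q h have the same pairing with
  \<Psi>; this needs the sum of |\<Psi>(j)|^2 to be nonzero.\<close>

lemma Psi_residual:
  assumes h: "h \<in> Zspace n N"
  shows "(\<Sum>t = 0..<N. \<Psi> t \<bullet> residual h t) = 0"
proof -
  let ?\<kappa> = "\<Sum>j = 0..<N. (vnorm (\<Psi> j))\<^sup>2" and ?S = "\<Sum>i = 0..<N. \<Psi> i \<bullet> h i"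
  have "\<Psi> t \<bullet> residual h t = \<Psi> t \<bullet> h t - inverse ?\<kappa> * ?S * (vnorm (\<Psi> t))\<^sup>2" if t: "t < N" for t
  proof -
    have "h t \<in> carrier_vec n" using h t by (auto simp: Zspace_def)
    then show ?thesis
      using t Psi_carrier[OF t]
      by (simp add: residual_def Qop_def scalar_prod_minus_distrib[of _ n] vnorm_power2)
  qed
  then have "(\<Sum>t = 0..<N. \<Psi> t \<bullet> residual h t) = ?S - inverse ?\<kappa> * ?S * ?\<kappa>"
    by (simp add: sum_subtractf sum_distrib_left)
  then show ?thesis using Psi_nonzero by simp
qed

lemma residual_in_range: "h \<in> Zspace n N \<Longrightarrow> residual h \<in> Lop n N a ` kerP n N a b"
  by (intro Lop_surj residual_in_Zspace Psi_residual)

lemma MpIQ_in_kerP: "h \<in> Zspace n N \<Longrightarrow> MpIQ n N a b w h \<in> kerP n N a b"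
  unfolding MpIQ_def Mp_def residual_def[symmetric]
  by (rule the_inv_into_into[OF Lop_inj_on_kerP residual_in_range]) auto

lemma Lop_MpIQ: "h \<in> Zspace n N \<Longrightarrow> Lop n N a (MpIQ n N a b w h) = residual h"
  unfolding MpIQ_def Mp_def residual_def[symmetric]
  by (rule f_the_inv_into_f[OF Lop_inj_on_kerP residual_in_range])

text \<open>Uniqueness is the working characterisation of M_p (I - Q): any element of ker P that L
  maps to the residual is its value, so the choice inside \<open>the_inv_into\<close> never has to
  be unfolded again.\<close>

lemma MpIQ_eqI: "x \<in> kerP n N a b \<Longrightarrow> Lop n N a x = residual h \<Longrightarrow> MpIQ n N a b w h = x"
  unfolding MpIQ_def Mp_def residual_def[symmetric]
  by (rule the_inv_into_f_eq[OF Lop_inj_on_kerP])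

lemma MpIQ_carrier: "h \<in> Zspace n N \<Longrightarrow> t \<le> N \<Longrightarrow> MpIQ n N a b w h t \<in> carrier_vec n"
  using MpIQ_in_kerP[of h] by (auto simp: kerP_iff)

lemma lincomb_in_Zspace: "(\<lambda>t\<in>{0..<N}. lincomb_vec n I c (\<lambda>i. H i t)) \<in> Zspace n N"
  by (simp add: Zspace_def)

lemma residual_lincomb:
  assumes H: "\<And>i. i \<in> I \<Longrightarrow> H i \<in> Zspace n N" and t: "t < N"
  shows "residual (\<lambda>t\<in>{0..<N}. lincomb_vec n I c (\<lambda>i. H i t)) t = lincomb_vec n I c (\<lambda>i. residual (H i) t)"
proof (rule eq_vecI)
  let ?\<kappa> = "inverse (\<Sum>j = 0..<N. (vnorm (\<Psi> j))\<^sup>2)"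
  let ?h = "\<lambda>t\<in>{0..<N}. lincomb_vec n I c (\<lambda>i. H i t)"
  fix j assume "j < dim_vec (lincomb_vec n I c (\<lambda>i. residual (H i) t))"
  then have j: "j < n" by (simp add: lincomb_vec_def)
  have "(\<Sum>i = 0..<N. \<Psi> i \<bullet> ?h i) = (\<Sum>s = 0..<N. \<Sum>i\<in>I. c i * (\<Psi> s \<bullet> H i s))"
    by (intro sum.cong refl) (simp add: scalar_prod_lincomb_vec[OF Zspace_mem[OF H]])
  also have "\<dots> = (\<Sum>i\<in>I. c i * (\<Sum>s = 0..<N. \<Psi> s \<bullet> H i s))"
    by (subst sum.swap) (simp add: sum_distrib_left)
  finally show "residual ?h t $ j = lincomb_vec n I c (\<lambda>i. residual (H i) t) $ j"
    using t j H
    by (simp add: index_residual lincomb_in_Zspace index_lincomb_vec algebra_simps sum_subtractf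
        sum_distrib_left sum_distrib_right)
next
  have "residual (\<lambda>t\<in>{0..<N}. lincomb_vec n I c (\<lambda>i. H i t)) t \<in> carrier_vec n"
    by (rule Zspace_mem[OF residual_in_Zspace[OF lincomb_in_Zspace] t])
  then show "dim_vec (residual (\<lambda>t\<in>{0..<N}. lincomb_vec n I c (\<lambda>i. H i t)) t)
      = dim_vec (lincomb_vec n I c (\<lambda>i. residual (H i) t))"
    by (simp add: lincomb_vec_def)
qed

text \<open>Linearity by uniqueness: the combination of the images satisfies the linear conditions
  defining ker P, and L maps it to the residual of the combined right-hand side.\<close>

lemma MpIQ_lincomb:
  assumes H: "\<And>i. i \<in> I \<Longrightarrow> H i \<in> Zspace n N"
  shows "MpIQ n N a b w (\<lambda>t\<in>{0..<N}. lincomb_vec n I c (\<lambda>i. H i t))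
    = (\<lambda>t\<in>{0..N}. lincomb_vec n I c (\<lambda>i. MpIQ n N a b w (H i) t))"
proof (rule MpIQ_eqI)
  define X where "X i = MpIQ n N a b w (H i)" for i
  let ?x = "\<lambda>t\<in>{0..N}. lincomb_vec n I c (\<lambda>i. MpIQ n N a b w (H i) t)"
  have X: "X i \<in> {0..N} \<rightarrow>\<^sub>E carrier_vec n" "boundary (X i) = 0\<^sub>v n" "X i 0 \<bullet> u = 0"
    if "i \<in> I" for i
    using MpIQ_in_kerP[OF H[OF that]] unfolding X_def kerP_iff by auto
  have Xc: "X i t \<in> carrier_vec n" if "i \<in> I" "t \<le> N" for i t
    using PiE_mem[OF X(1)[OF that(1)]] that by auto
  have x: "?x \<in> {0..N} \<rightarrow>\<^sub>E carrier_vec n" by simp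
  have "boundary ?x = 0\<^sub>v n"
  proof (rule eq_vecI)
    fix j assume "j < dim_vec (0\<^sub>v n)"
    then have j: "j < n" by simp
    have "boundary ?x $ j = (\<Sum>k = 0..N. (B k *\<^sub>v ?x k) $ j)"
      by (rule index_finsum_vec[OF _ j boundary_summand_carrier[OF x]]) simp
    also have "\<dots> = (\<Sum>k = 0..N. \<Sum>i\<in>I. c i * (B k *\<^sub>v X i k) $ j)"
    proof (intro sum.cong refl)
      fix k assume k: "k \<in> {0..N}"
      have "B k *\<^sub>v ?x k = lincomb_vec n I c (\<lambda>i. B k *\<^sub>v X i k)"
        using k Xc by (simp add: X_def[symmetric] mult_mat_lincomb_vec[OF bmat_carrier])
      then show "(B k *\<^sub>v ?x k) $ j = (\<Sum>i\<in>I. c i * (B k *\<^sub>v X i k) $ j)"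
        using j by (simp only: index_lincomb_vec)
    qed
    also have "\<dots> = (\<Sum>i\<in>I. c i * (\<Sum>k = 0..N. (B k *\<^sub>v X i k) $ j))"
      by (subst sum.swap) (simp add: sum_distrib_left)
    also have "\<dots> = (\<Sum>i\<in>I. c i * boundary (X i) $ j)"
      by (intro sum.cong refl) (subst index_finsum_vec[OF _ j boundary_summand_carrier[OF X(1)]], auto)
    also have "\<dots> = 0" using X(2) j by simp
    finally show "boundary ?x $ j = 0\<^sub>v n $ j" using j by simp
  next
    show "dim_vec (boundary ?x) = dim_vec (0\<^sub>v n)"
      using carrier_vecD[OF finsum_vec_closed[OF boundary_summand_carrier[OF x]]] by simp
  qed
  moreover have "?x 0 \<bullet> u = 0"
    using X(3) by (simp add: lincomb_vec_scalar_prod X_def)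
  ultimately show "?x \<in> kerP n N a b"
    using x by (simp add: kerP_iff)
  show "Lop n N a ?x = residual (\<lambda>t\<in>{0..<N}. lincomb_vec n I c (\<lambda>i. H i t))"
    unfolding Lop_eq_iff[OF x residual_in_Zspace[OF lincomb_in_Zspace]]
  proof (intro allI impI)
    fix t assume t: "t < N"
    have step: "X i (Suc t) = C t *\<^sub>v X i t + residual (H i) t" if "i \<in> I" for i
      using Lop_MpIQ[OF H[OF that]] Lop_eq_iff[OF X(1)[OF that] residual_in_Zspace[OF H[OF that]]] t
      by (simp add: X_def)
    have res: "residual (H i) t \<in> carrier_vec n" if "i \<in> I" for i
      using residual_in_Zspace[OF H[OF that]] t by (auto simp: Zspace_def)
    have "lincomb_vec n I c (\<lambda>i. X i (Suc t))
        = lincomb_vec n I c (\<lambda>i. C t *\<^sub>v X i t) + lincomb_vec n I c (\<lambda>i. residual (H i) t)"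
    proof (rule eq_vecI)
      fix j assume "j < dim_vec (lincomb_vec n I c (\<lambda>i. C t *\<^sub>v X i t) + lincomb_vec n I c (\<lambda>i. residual (H i) t))"
      then have j: "j < n" by (simp add: lincomb_vec_def)
      have "X i (Suc t) $ j = (C t *\<^sub>v X i t) $ j + residual (H i) t $ j" if "i \<in> I" for i
        unfolding step[OF that] using res[OF that] j by (subst index_add_vec) auto
      then show "lincomb_vec n I c (\<lambda>i. X i (Suc t)) $ j
          = (lincomb_vec n I c (\<lambda>i. C t *\<^sub>v X i t) + lincomb_vec n I c (\<lambda>i. residual (H i) t)) $ j"
        using j by (simp add: lincomb_vec_def distrib_left sum.distrib del: index_mult_mat_vec)
    qed (simp add: lincomb_vec_def)
    moreover have "C t *\<^sub>v lincomb_vec n I c (\<lambda>i. X i t) = lincomb_vec n I c (\<lambda>i. C t *\<^sub>v X i t)"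
      using Xc t by (intro mult_mat_lincomb_vec[OF companion_carrier]) auto
    ultimately show "?x (Suc t) = C t *\<^sub>v ?x t + residual (\<lambda>t\<in>{0..<N}. lincomb_vec n I c (\<lambda>i. H i t)) t"
      using t by (simp add: X_def residual_lincomb[where H = H, OF H t])
  qed
qed

section \<open>Boundedness of M_p (I - Q) and its action on scalar forcings\<close>

definition pulse :: "nat \<Rightarrow> nat \<Rightarrow> nat \<Rightarrow> real vec" where
  "pulse \<tau> j = (\<lambda>t\<in>{0..<N}. if t = \<tau> then unit_vec n j else 0\<^sub>v n)"

lemma pulse_in_Zspace: "pulse \<tau> j \<in> Zspace n N"
  by (simp add: pulse_def Zspace_def)

text \<open>The pulses are the standard basis of Z, indexed by time and component; finiteness of
  this basis is what bounds the operator.\<close>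

lemma lincomb_pulses:
  assumes h: "h \<in> Zspace n N"
  shows "h = (\<lambda>t\<in>{0..<N}. lincomb_vec n ({0..<N} \<times> {0..<n}) (\<lambda>(\<tau>, j). h \<tau> $ j) (\<lambda>(\<tau>, j). pulse \<tau> j t))"
proof (rule PiE_ext[where k = "{0..<N}" and s = "\<lambda>_. carrier_vec n"])
  fix t assume t: "t \<in> {0..<N}"
  have "h t = lincomb_vec n ({0..<N} \<times> {0..<n}) (\<lambda>(\<tau>, j). h \<tau> $ j) (\<lambda>(\<tau>, j). pulse \<tau> j t)"
  proof (rule eq_vecI)
    fix i assume "i < dim_vec (lincomb_vec n ({0..<N} \<times> {0..<n}) (\<lambda>(\<tau>, j). h \<tau> $ j) (\<lambda>(\<tau>, j). pulse \<tau> j t))"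
    then have i: "i < n" by (simp add: lincomb_vec_def)
    have "(\<Sum>(\<tau>, j)\<in>{0..<N} \<times> {0..<n}. h \<tau> $ j * pulse \<tau> j t $ i)
        = (\<Sum>\<tau> = 0..<N. \<Sum>j = 0..<n. if \<tau> = t then if j = i then h t $ i else 0 else 0)"
      using t i unfolding sum.cartesian_product[symmetric] by (intro sum.cong refl) (auto simp: pulse_def)
    also have "\<dots> = h t $ i" using t i by (simp add: sum.swap[of _ "{0..<n}"])
    finally show "h t $ i = lincomb_vec n ({0..<N} \<times> {0..<n}) (\<lambda>(\<tau>, j). h \<tau> $ j) (\<lambda>(\<tau>, j). pulse \<tau> j t) $ i"
      using i by (simp add: index_lincomb_vec case_prod_unfold)
  qed (use carrier_vecD[OF Zspace_mem[OF h]] t in \<open>simp add: lincomb_vec_def\<close>)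
  then show "h t = (\<lambda>t\<in>{0..<N}. lincomb_vec n ({0..<N} \<times> {0..<n}) (\<lambda>(\<tau>, j). h \<tau> $ j) (\<lambda>(\<tau>, j). pulse \<tau> j t)) t"
    using t by simp
qed (use h in \<open>auto simp: Zspace_def\<close>)

text \<open>On the unit ball all coefficients in the basis of pulses are at most 1 in absolute
  value, so the entries of the images of the finitely many pulses give a uniform bound. This makes
  \<open>opnorm_ZX\<close> a genuine upper bound.\<close>

lemma MpIQ_bounded:
  "bdd_above ((\<lambda>h. supnorm {0..N} (MpIQ n N a b w h)) ` {h \<in> Zspace n N. supnorm {0..<N} h \<le> 1})"
proof (rule bdd_aboveI2)
  fix h assume "h \<in> {h \<in> Zspace n N. supnorm {0..<N} h \<le> 1}"
  then have h: "h \<in> Zspace n N" and h1: "supnorm {0..<N} h \<le> 1" by auto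
  let ?I = "{0..<N} \<times> {0..<n}"
  let ?K = "\<lambda>t. \<Sum>i = 0..<n. \<Sum>p\<in>?I. \<bar>MpIQ n N a b w (pulse (fst p) (snd p)) t $ i\<bar>"
  have h_le: "\<bar>h \<tau> $ j\<bar> \<le> 1" if "\<tau> < N" "j < n" for \<tau> j
  proof -
    have "h \<tau> \<in> carrier_vec n" using h that by (auto simp: Zspace_def)
    then show ?thesis
      using abs_index_le_vnorm[of "h \<tau>" n j] vnorm_le_supnorm[of "{0..<N}" \<tau> h] h1 that by simp
  qed
  have eq: "MpIQ n N a b w h = (\<lambda>t\<in>{0..N}. lincomb_vec n ?I (\<lambda>(\<tau>, j). h \<tau> $ j)
      (\<lambda>p. MpIQ n N a b w (pulse (fst p) (snd p)) t))"
    by (subst lincomb_pulses[OF h])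
      (simp add: case_prod_unfold MpIQ_lincomb[where H = "\<lambda>p. pulse (fst p) (snd p)"] pulse_in_Zspace)
  have "vnorm (MpIQ n N a b w h t) \<le> (\<Sum>t = 0..N. ?K t)" if t: "t \<in> {0..N}" for t
  proof -
    have "vnorm (MpIQ n N a b w h t) \<le> (\<Sum>i = 0..<n. \<bar>MpIQ n N a b w h t $ i\<bar>)"
      using MpIQ_carrier[OF h] t by (intro vnorm_le_sum_abs) auto
    also have "\<dots> \<le> ?K t"
    proof (rule sum_mono)
      fix i assume i: "i \<in> {0..<n}"
      have "\<bar>MpIQ n N a b w h t $ i\<bar>
          = \<bar>\<Sum>p\<in>?I. h (fst p) $ snd p * MpIQ n N a b w (pulse (fst p) (snd p)) t $ i\<bar>"
        using t i by (simp add: eq index_lincomb_vec case_prod_unfold)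
      also have "\<dots> \<le> (\<Sum>p\<in>?I. \<bar>h (fst p) $ snd p * MpIQ n N a b w (pulse (fst p) (snd p)) t $ i\<bar>)"
        by (rule sum_abs)
      also have "\<dots> \<le> (\<Sum>p\<in>?I. \<bar>MpIQ n N a b w (pulse (fst p) (snd p)) t $ i\<bar>)"
        using h_le by (intro sum_mono) (auto simp: abs_mult intro!: mult_left_le_one_le)
      finally show "\<bar>MpIQ n N a b w h t $ i\<bar> \<le> (\<Sum>p\<in>?I. \<bar>MpIQ n N a b w (pulse (fst p) (snd p)) t $ i\<bar>)" .
    qed
    also have "?K t \<le> (\<Sum>t = 0..N. ?K t)"
      using t by (intro member_le_sum) (auto intro!: sum_nonneg)
    finally show ?thesis .
  qed
  then show "supnorm {0..N} (MpIQ n N a b w h) \<le> (\<Sum>t = 0..N. ?K t)"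
    by (subst supnorm_le_iff) auto
qed

text \<open>In the first-order system a scalar right-hand side enters the last component only. Its
  Euclidean norm at each time is the absolute value of the scalar.\<close>

definition forcing :: "(nat \<Rightarrow> real) \<Rightarrow> nat \<Rightarrow> real vec" where
  "forcing f = (\<lambda>t\<in>{0..<N}. f t \<cdot>\<^sub>v unit_vec n (n - 1))"

lemma forcing_in_Zspace: "forcing f \<in> Zspace n N"
  by (simp add: forcing_def Zspace_def)

text \<open>A discrete Green function: the pulses in the last component are enough to expand a
  scalar forcing, and their images are the coefficients.\<close>

lemma MpIQ_forcing:
  assumes "t \<le> N" "i < n"
  shows "MpIQ n N a b w (forcing f) t $ i = (\<Sum>\<tau> = 0..<N. MpIQ n N a b w (pulse \<tau> (n - 1)) t $ i * f \<tau>)"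
proof -
  have "forcing f = (\<lambda>t\<in>{0..<N}. lincomb_vec n {0..<N} f (\<lambda>\<tau>. pulse \<tau> (n - 1) t))"
  proof (rule PiE_ext[where k = "{0..<N}" and s = "\<lambda>_. carrier_vec n"])
    fix t assume t: "t \<in> {0..<N}"
    have "f t \<cdot>\<^sub>v unit_vec n (n - 1) = lincomb_vec n {0..<N} f (\<lambda>\<tau>. pulse \<tau> (n - 1) t)"
    proof (rule eq_vecI)
      fix j assume "j < dim_vec (lincomb_vec n {0..<N} f (\<lambda>\<tau>. pulse \<tau> (n - 1) t))"
      then have j: "j < n" by (simp add: lincomb_vec_def)
      have "(\<Sum>\<tau> = 0..<N. f \<tau> * pulse \<tau> (n - 1) t $ j)
          = (\<Sum>\<tau> = 0..<N. if \<tau> = t then f t * unit_vec n (n - 1) $ j else 0)"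
        using t j by (intro sum.cong refl) (auto simp: pulse_def simp del: index_unit_vec(1,2))
      then show "(f t \<cdot>\<^sub>v unit_vec n (n - 1)) $ j = lincomb_vec n {0..<N} f (\<lambda>\<tau>. pulse \<tau> (n - 1) t) $ j"
        using j t by (simp add: index_lincomb_vec del: index_unit_vec(1,2))
    qed (simp add: lincomb_vec_def)
    then show "forcing f t = (\<lambda>t\<in>{0..<N}. lincomb_vec n {0..<N} f (\<lambda>\<tau>. pulse \<tau> (n - 1) t)) t"
      using t by (simp add: forcing_def)
  qed (use forcing_in_Zspace in \<open>auto simp: Zspace_def\<close>)
  then have "MpIQ n N a b w (forcing f)
      = (\<lambda>t\<in>{0..N}. lincomb_vec n {0..<N} f (\<lambda>\<tau>. MpIQ n N a b w (pulse \<tau> (n - 1)) t))"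
    by (simp add: MpIQ_lincomb pulse_in_Zspace)
  then show ?thesis using assms by (simp add: index_lincomb_vec mult_ac)
qed

text \<open>Rescaling by \<open>H\<close> brings the forcing into the unit ball of Z, where the
  operator norm applies; one component is at most the Euclidean norm.\<close>

lemma MpIQ_forcing_bound:
  assumes f: "\<And>\<tau>. \<tau> < N \<Longrightarrow> \<bar>f \<tau>\<bar> \<le> H" and t: "t \<le> N" and i: "i < n"
  shows "\<bar>MpIQ n N a b w (forcing f) t $ i\<bar> \<le> opnorm_ZX n N (MpIQ n N a b w) * H"
proof -
  have H0: "0 \<le> H" using f[OF N_pos] by linarith
  \<comment> \<open>If \<open>H\<close> is 0, then \<open>f\<close> vanishes at all times below
    \<open>N\<close> and the quotient is 0 by convention, so f = f' * H holds there in this case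
    too.\<close>
  define f' where "f' \<tau> = f \<tau> / H" for \<tau>
  have f': "\<bar>f' \<tau>\<bar> \<le> 1" "f \<tau> = f' \<tau> * H" if "\<tau> < N" for \<tau>
    using f[OF that] H0 by (auto simp: f'_def divide_le_eq_1)
  have "vnorm (forcing f' \<tau>) \<le> 1" if "\<tau> < N" for \<tau>
  proof -
    have "vnorm (forcing f' \<tau>) = sqrt ((f' \<tau>)\<^sup>2)"
      using that n_pos by (simp add: vnorm_def forcing_def power2_eq_square)
    then show ?thesis using f'(1)[OF that] by simp
  qed
  then have "supnorm {0..<N} (forcing f') \<le> 1"
    using N_pos by (subst supnorm_le_iff) auto
  then have "supnorm {0..N} (MpIQ n N a b w (forcing f')) \<le> opnorm_ZX n N (MpIQ n N a b w)"
    unfolding opnorm_ZX_def using forcing_in_Zspace by (intro cSUP_upper MpIQ_bounded) auto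
  moreover have "\<bar>MpIQ n N a b w (forcing f') t $ i\<bar> \<le> supnorm {0..N} (MpIQ n N a b w (forcing f'))"
    using abs_index_le_vnorm[OF MpIQ_carrier[OF forcing_in_Zspace[of f'] t] i]
      vnorm_le_supnorm[of "{0..N}" t "MpIQ n N a b w (forcing f')"] t by simp
  ultimately have "\<bar>MpIQ n N a b w (forcing f') t $ i\<bar> * H \<le> opnorm_ZX n N (MpIQ n N a b w) * H"
    using H0 by (intro mult_right_mono) auto
  moreover have "MpIQ n N a b w (forcing f) t $ i = MpIQ n N a b w (forcing f') t $ i * H"
    unfolding MpIQ_forcing[OF t i] sum_distrib_right using f'(2) by (intro sum.cong refl) (auto simp: mult_ac)
  ultimately show ?thesis using H0 by (simp add: abs_mult)
qed

lemma Psi_forcing: "t < N \<Longrightarrow> \<Psi> t \<bullet> forcing f t = Psi_n n N a b w t * f t"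
  using n_pos Psi_carrier[of t] by (simp add: forcing_def Psi_n_def)

text \<open>The hypothesis is the solvability condition: it makes the coefficient in
  \<open>Qop\<close> zero, so the residual is the forcing itself.\<close>

lemma Lop_MpIQ_forcing:
  assumes "(\<Sum>t = 0..<N. Psi_n n N a b w t * f t) = 0"
  shows "Lop n N a (MpIQ n N a b w (forcing f)) = forcing f"
proof -
  have "(\<Sum>i = 0..<N. \<Psi> i \<bullet> forcing f i) = 0"
    using assms by (simp add: Psi_forcing)
  then have "residual (forcing f) t $ j = forcing f t $ j" if "t < N" "j < n" for t j
    using that by (simp add: index_residual forcing_in_Zspace)
  then have "residual (forcing f) t = forcing f t" if "t < N" for t
    using carrier_vecD[OF Zspace_mem[OF residual_in_Zspace[OF forcing_in_Zspace] that]]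
      carrier_vecD[OF Zspace_mem[OF forcing_in_Zspace that]] that
    by (intro eq_vecI) simp_all
  then have "residual (forcing f) = forcing f"
    using residual_in_Zspace[OF forcing_in_Zspace] forcing_in_Zspace unfolding Zspace_def
    by (intro PiE_ext[where k = "{0..<N}" and s = "\<lambda>_. carrier_vec n"]) auto
  then show ?thesis by (simp add: Lop_MpIQ forcing_in_Zspace)
qed

text \<open>Superposition: the multiple of S solves the homogeneous recurrence and has boundary
  value \<alpha> D u = 0, while the M_p term carries the forcing and meets the boundary conditions
  as an element of ker P.\<close>

lemma boundary_value_solution:
  fixes \<alpha> :: real
  assumes f: "(\<Sum>t = 0..<N. Psi_n n N a b w t * f t) = 0"
  defines "x \<equiv> \<lambda>t. \<alpha> \<cdot>\<^sub>v Svec n a u t + MpIQ n N a b w (forcing f) t"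
  shows "\<And>t. t \<le> N \<Longrightarrow> x t \<in> carrier_vec n"
    and "\<And>t. t < N \<Longrightarrow> x (Suc t) = C t *\<^sub>v x t + forcing f t"
    and "boundary x = 0\<^sub>v n"
proof -
  define X where "X = MpIQ n N a b w (forcing f)"
  have X: "X \<in> {0..N} \<rightarrow>\<^sub>E carrier_vec n" "boundary X = 0\<^sub>v n"
    using MpIQ_in_kerP[OF forcing_in_Zspace] unfolding X_def kerP_iff by auto
  have Xc: "X t \<in> carrier_vec n" if "t \<le> N" for t using X(1) that by auto
  have Sc: "Svec n a u t \<in> carrier_vec n" for t by (simp add: Svec_def)
  show xc: "x t \<in> carrier_vec n" if "t \<le> N" for t
    unfolding x_def X_def[symmetric] using Xc[OF that] Sc by simp
  show "x (Suc t) = C t *\<^sub>v x t + forcing f t" if t: "t < N" for t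
  proof -
    have F: "forcing f t \<in> carrier_vec n" using forcing_in_Zspace t by (rule Zspace_mem)
    have "X (Suc t) = C t *\<^sub>v X t + forcing f t"
      using Lop_MpIQ_forcing[OF f] Lop_eq_iff[OF X(1) forcing_in_Zspace, of f] t by (simp add: X_def)
    moreover have "Svec n a u (Suc t) = C t *\<^sub>v Svec n a u t"
      unfolding Svec_def by (rule Phi_Suc_mult_vec) simp
    ultimately have "x (Suc t) = \<alpha> \<cdot>\<^sub>v (C t *\<^sub>v Svec n a u t) + (C t *\<^sub>v X t + forcing f t)"
      by (simp add: x_def X_def)
    also have "\<dots> = (\<alpha> \<cdot>\<^sub>v (C t *\<^sub>v Svec n a u t) + C t *\<^sub>v X t) + forcing f t"
      using F Sc Xc t by (intro assoc_add_vec[symmetric, of _ n]) auto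
    also have "\<alpha> \<cdot>\<^sub>v (C t *\<^sub>v Svec n a u t) + C t *\<^sub>v X t = C t *\<^sub>v x t"
      unfolding x_def X_def[symmetric] using Sc Xc t
      by (simp add: mult_add_distrib_mat_vec[OF companion_carrier] mult_mat_vec[OF companion_carrier])
    finally show ?thesis .
  qed
  show "boundary x = 0\<^sub>v n"
  proof (rule eq_vecI)
    have c: "(\<lambda>k. B k *\<^sub>v x k) \<in> {0..N} \<rightarrow> carrier_vec n"
      using xc by (intro Pi_I mult_vec_carrier) simp
    show "dim_vec (boundary x) = dim_vec (0\<^sub>v n)"
      using carrier_vecD[OF finsum_vec_closed[OF c]] by simp
    fix i assume "i < dim_vec (0\<^sub>v n)"
    then have i: "i < n" by simp
    have "boundary x $ i = (\<Sum>k = 0..N. (B k *\<^sub>v x k) $ i)"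
      by (rule index_finsum_vec[OF _ i c]) simp
    also have "\<dots> = (\<Sum>k = 0..N. \<alpha> * (B k *\<^sub>v (\<Phi> k *\<^sub>v u)) $ i + (B k *\<^sub>v X k) $ i)"
    proof (intro sum.cong refl)
      fix k assume k: "k \<in> {0..N}"
      have "B k *\<^sub>v x k = \<alpha> \<cdot>\<^sub>v (B k *\<^sub>v (\<Phi> k *\<^sub>v u)) + B k *\<^sub>v X k"
        unfolding x_def X_def[symmetric] Svec_def using Xc k
        by (simp add: mult_add_distrib_mat_vec[OF bmat_carrier] mult_mat_vec[OF bmat_carrier])
      then show "(B k *\<^sub>v x k) $ i = \<alpha> * (B k *\<^sub>v (\<Phi> k *\<^sub>v u)) $ i + (B k *\<^sub>v X k) $ i"
        using i by simp
    qed
    also have "\<dots> = \<alpha> * (D *\<^sub>v u) $ i + boundary X $ i"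
      unfolding Dmat_mult_vec[OF u_carrier] sum.distrib using i
      by (simp add: index_finsum_vec boundary_summand_carrier[OF X(1)] sum_distrib_left Pi_I del: index_mult_mat_vec)
    also have "\<dots> = 0" using D_u X(2) i by simp
    finally show "boundary x $ i = 0\<^sub>v n $ i" using i by simp
  qed
qed

end

section \<open>The nonlinear problem\<close>

text \<open>For the unknown z_i the function is z_i minus the right-hand side of its equation. The
  hypothesis \<open>bound\<close> keeps that right-hand side within \<beta> in absolute value, which
  gives the signs on the faces z_i = -\<beta> and z_i = \<beta>; \<open>neg\<close> and
  \<open>pos\<close> give them on the two faces in \<alpha>.\<close>

lemma bifurcation_equation_solvable:
  fixes G :: "nat \<Rightarrow> nat \<Rightarrow> real" and f :: "nat \<Rightarrow> real \<Rightarrow> real" and s \<psi> :: "nat \<Rightarrow> real"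
  assumes cont: "\<And>t. t < N \<Longrightarrow> continuous_on UNIV (f t)"
    and r: "0 \<le> \<rho>" "0 \<le> \<beta>"
    and bound: "\<And>\<alpha> z t. \<bar>\<alpha>\<bar> \<le> \<rho> \<Longrightarrow> (\<And>\<tau>. \<tau> < N \<Longrightarrow> \<bar>z \<tau>\<bar> \<le> \<beta>) \<Longrightarrow> t < N \<Longrightarrow>
      \<bar>\<Sum>\<tau> = 0..<N. G t \<tau> * f \<tau> (\<alpha> * s \<tau> + z \<tau>)\<bar> \<le> \<beta>"
    and pos: "\<And>z. (\<And>\<tau>. \<tau> < N \<Longrightarrow> \<bar>z \<tau>\<bar> \<le> \<beta>) \<Longrightarrow> 0 \<le> (\<Sum>t = 0..<N. \<psi> t * f t (\<rho> * s t + z t))"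
    and neg: "\<And>z. (\<And>\<tau>. \<tau> < N \<Longrightarrow> \<bar>z \<tau>\<bar> \<le> \<beta>) \<Longrightarrow> (\<Sum>t = 0..<N. \<psi> t * f t (- \<rho> * s t + z t)) \<le> 0"
  obtains \<alpha> z where "\<And>t. t < N \<Longrightarrow> z t = (\<Sum>\<tau> = 0..<N. G t \<tau> * f \<tau> (\<alpha> * s \<tau> + z \<tau>))"
    "(\<Sum>t = 0..<N. \<psi> t * f t (\<alpha> * s t + z t)) = 0"
proof -
  text \<open>The unknowns are \<open>z 0, \<dots>, z (N - 1)\<close> and, as coordinate \<open>N\<close>, the parameter \<open>\<alpha>\<close>.\<close>
  define F where "F i x = (if i < N then x i - (\<Sum>\<tau> = 0..<N. G i \<tau> * f \<tau> (x N * s \<tau> + x \<tau>))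
      else \<Sum>t = 0..<N. \<psi> t * f t (x N * s t + x t))" for i and x :: "nat \<Rightarrow> real"
  define h where "h i = (if i < N then \<beta> else \<rho>)" for i
  have box: "\<bar>x N\<bar> \<le> \<rho>" "\<And>\<tau>. \<tau> < N \<Longrightarrow> \<bar>x \<tau>\<bar> \<le> \<beta>"
    if "\<And>j. j < Suc N \<Longrightarrow> x j \<in> {- h j..h j}" for x
  proof -
    show "\<bar>x N\<bar> \<le> \<rho>" using that[of N] by (auto simp: h_def abs_le_iff)
    show "\<bar>x \<tau>\<bar> \<le> \<beta>" if "\<tau> < N" for \<tau>
      using \<open>\<And>j. j < Suc N \<Longrightarrow> x j \<in> {- h j..h j}\<close>[of \<tau>] that by (auto simp: h_def abs_le_iff)
  qed
  obtain x where x: "\<And>i. i < Suc N \<Longrightarrow> F i x = 0"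
  proof (rule poincare_miranda[of "Suc N" "\<lambda>i. - h i" h F])
    fix i X and l :: "nat \<Rightarrow> real" assume "i < Suc N" and X: "\<And>j. j < Suc N \<Longrightarrow> (\<lambda>k. X k j) \<longlonglongrightarrow> l j"
    have "(\<lambda>k. f t (X k N * s t + X k t)) \<longlonglongrightarrow> f t (l N * s t + l t)" if t: "t < N" for t
      by (rule continuous_on_tendsto_compose[OF cont[OF t]]) (use t X in \<open>auto intro!: tendsto_intros\<close>)
    then show "(\<lambda>k. F i (X k)) \<longlonglongrightarrow> F i l"
      using X[OF \<open>i < Suc N\<close>] unfolding F_def by (auto intro!: tendsto_intros)
  next
    fix i x assume i: "i < Suc N" and x: "\<And>j. j < Suc N \<Longrightarrow> x j \<in> {- h j..h j}" and xi: "x i = - h i"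
    show "F i x \<le> 0"
    proof (cases "i < N")
      case True
      then have "\<bar>\<Sum>\<tau> = 0..<N. G i \<tau> * f \<tau> (x N * s \<tau> + x \<tau>)\<bar> \<le> \<beta>"
        by (intro bound box[OF x])
      then show ?thesis using True xi by (simp add: F_def h_def abs_le_iff)
    next
      case False
      then have "i = N" using i by simp
      moreover have "(\<Sum>t = 0..<N. \<psi> t * f t (- \<rho> * s t + x t)) \<le> 0"
        by (intro neg box[OF x])
      ultimately show ?thesis using xi by (simp add: F_def h_def)
    qed
  next
    fix i x assume i: "i < Suc N" and x: "\<And>j. j < Suc N \<Longrightarrow> x j \<in> {- h j..h j}" and xi: "x i = h i"
    show "0 \<le> F i x"
    proof (cases "i < N")
      case True
      then have "\<bar>\<Sum>\<tau> = 0..<N. G i \<tau> * f \<tau> (x N * s \<tau> + x \<tau>)\<bar> \<le> \<beta>"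
        by (intro bound box[OF x])
      then show ?thesis using True xi by (simp add: F_def h_def abs_le_iff)
    next
      case False
      then have "i = N" using i by simp
      moreover have "0 \<le> (\<Sum>t = 0..<N. \<psi> t * f t (\<rho> * s t + x t))"
        by (intro pos box[OF x])
      ultimately show ?thesis using xi by (simp add: F_def h_def)
    qed
  qed (use r in \<open>auto simp: h_def\<close>)
  show thesis
  proof (rule that)
    show "x t = (\<Sum>\<tau> = 0..<N. G t \<tau> * f \<tau> (x N * s \<tau> + x \<tau>))" if "t < N" for t
      using x[of t] that by (simp add: F_def)
    show "(\<Sum>t = 0..<N. \<psi> t * f t (x N * s t + x t)) = 0"
      using x[of N] by (simp add: F_def)
  qed
qed

text \<open>The shift relation makes \<open>x t $ j\<close> depend on t + j only, so the vectors are
  windows of one scalar sequence.\<close>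

lemma shift_orbit_scalar:
  fixes x :: "nat \<Rightarrow> 'a vec"
  assumes shift: "\<And>t i. t < N \<Longrightarrow> Suc i < n \<Longrightarrow> x (Suc t) $ i = x t $ Suc i"
  obtains y where "\<And>t j. t \<le> N \<Longrightarrow> j < n \<Longrightarrow> y (t + j) = x t $ j"
proof
  have shifts: "x (t + i) $ (j - i) = x t $ j" if "t + i \<le> N" "i \<le> j" "j < n" for t i j
    using that
  proof (induction i)
    case (Suc i)
    then have "x (Suc (t + i)) $ (j - Suc i) = x (t + i) $ Suc (j - Suc i)"
      by (intro shift) auto
    then show ?case using Suc by (simp add: Suc_diff_Suc)
  qed simp
  fix t j assume "t \<le> N" "j < n"
  \<comment> \<open>Up to time \<open>N\<close> the sequence is read off first components; the
    remaining values come from the last vector. Accordingly one shifts by j steps, down to component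
    0, or by N - t steps, up to time N.\<close>
  then show "(\<lambda>k. if k \<le> N then x k $ 0 else x N $ (k - N)) (t + j) = x t $ j"
    using shifts[of t j j] shifts[of t "N - t" j] by (auto simp: add.commute)
qed

text \<open>The supremum in \<open>gnorm\<close> is finite because \<open>g\<close> is continuous
  and a finite set of times times a closed interval is compact.\<close>

lemma abs_le_gnorm:
  assumes g: "continuous_on UNIV g" and t: "t < N" and x: "\<bar>x\<bar> \<le> r"
  shows "\<bar>g (real t, x)\<bar> \<le> gnorm N g r"
proof -
  let ?h = "\<lambda>p. \<bar>g p\<bar>"
  have "compact (?h ` (real ` {0..<N} \<times> {-r..r}))"
    using g by (intro compact_continuous_image compact_Times continuous_on_rabs)
      (auto intro: continuous_on_subset finite_imp_compact)
  then have "bdd_above (?h ` (real ` {0..<N} \<times> {-r..r}))"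
    by (intro bounded_imp_bdd_above compact_imp_bounded)
  moreover have "(\<lambda>(t, x). \<bar>g (real t, x)\<bar>) ` ({0..<N} \<times> {-r..r}) = ?h ` (real ` {0..<N} \<times> {-r..r})"
    by force
  ultimately have "bdd_above ((\<lambda>(t, x). \<bar>g (real t, x)\<bar>) ` ({0..<N} \<times> {-r..r}))"
    by simp
  then have "(\<lambda>(t, x). \<bar>g (real t, x)\<bar>) (t, x) \<le> gnorm N g r"
    unfolding gnorm_def using t x by (intro cSUP_upper) (auto simp: abs_le_iff)
  then show ?thesis by simp
qed

lemma Oall_iff: "t \<in> Oall N \<psi> s \<longleftrightarrow> t < N \<and> \<psi> t \<noteq> 0 \<and> s t \<noteq> 0"
  by (auto simp: Oall_def Opp_def Opm_def Omp_def Omm_def)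

theorem theorem3p1:
  fixes n m N :: nat
    and a :: "nat \<Rightarrow> nat \<Rightarrow> real"
    and b :: "nat \<Rightarrow> nat \<Rightarrow> nat \<Rightarrow> real"
    and g :: "real \<times> real \<Rightarrow> real"
    and u w :: "real vec"
    and \<psi> s :: "nat \<Rightarrow> real"
    and A c d J1 J2 :: real
    and W1 U1 w1 u1 W2 U2 w2 u2 :: "nat \<Rightarrow> real"
  assumes n: "n \<ge> 1" and N: "N > 2" and m: "1 \<le> m" "m \<le> n"
    and g: "continuous_on UNIV g"
    and a0: "\<forall>t\<in>{0..<N}. a 0 t \<noteq> 0"
    and full_row_rank: "vec_space.rank n (augmented n N b) = n"
    and resonance: "kernel_dim (Dmat n N a b) = 1"
    and u: "spans_line u (mat_kernel (Dmat n N a b))"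
    and w: "spans_line w (mat_kernel (transpose_mat (Dmat n N a b)))"
    and \<psi>: "\<psi> = Psi_n n N a b w"
    and s: "s = S_m n m a u"
    and A: "A = opnorm_ZX n N (MpIQ n N a b w)"
    and O_nonempty: "Oall N \<psi> s \<noteq> {}"
    and C1: "Ozero N \<psi> s = {}"
    and cd: "0 < c" "c < d"
    and C2pp: "\<forall>t\<in>Opp N \<psi> s. (\<forall>x\<in>{c..d}. W1 t < g (real t, x)) \<and>
                                (\<forall>x\<in>{-d..-c}. g (real t, x) < U1 t)"
    and C2pm: "\<forall>t\<in>Opm N \<psi> s. (\<forall>x\<in>{c..d}. g (real t, x) < u1 t) \<and>
                                (\<forall>x\<in>{-d..-c}. w1 t < g (real t, x))"
    and C2mp: "\<forall>t\<in>Omp N \<psi> s. (\<forall>x\<in>{c..d}. g (real t, x) < W2 t) \<and>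
                                (\<forall>x\<in>{-d..-c}. U2 t < g (real t, x))"
    and C2mm: "\<forall>t\<in>Omm N \<psi> s. (\<forall>x\<in>{c..d}. u2 t < g (real t, x)) \<and>
                                (\<forall>x\<in>{-d..-c}. g (real t, x) < w2 t)"
    and C3: "d > (c * smax N s + A * gnorm N g d * (smax N s + smin N \<psi> s)) / smin N \<psi> s"
    and J1: "J1 = (\<Sum>i = 0..<N. \<psi> i * glue N \<psi> s W1 w1 W2 w2 i)"
    and J2: "J2 = (\<Sum>i = 0..<N. \<psi> i * glue N \<psi> s U1 u1 U2 u2 i)"
    and C4: "J2 \<le> 0" "0 \<le> J1"
  shows "\<exists>y :: nat \<Rightarrow> real.
           (\<forall>t\<in>{0..<N}. y (t + n) + (\<Sum>j = 0..<n. a j t * y (t + j)) = g (real t, y (t + m - 1))) \<and>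
           (\<forall>i\<in>{1..n}. (\<Sum>k = 0..N. \<Sum>j = 1..n. b i j k * y (j + k - 1)) = 0)"
proof -
  have "t < N \<and> \<psi> t \<noteq> 0" if "t \<in> Oall N \<psi> s" for t using that by (simp add: Oall_iff)
  then have "\<exists>t<N. Psi_n n N a b w t \<noteq> 0" using O_nonempty \<psi> by blast
  then interpret resonant_problem n N a b u w
    using n a0 u w by unfold_locales auto
  have "finite (Oall N \<psi> s)"
    by (rule finite_subset[of _ "{0..<N}"]) (auto simp: Oall_iff)
  then have smin_le: "smin N \<psi> s \<le> \<bar>s t\<bar>" if "t \<in> Oall N \<psi> s" for t
    unfolding smin_def using that by (intro Min_le) auto
  have smin_pos: "0 < smin N \<psi> s"
    unfolding smin_def using O_nonempty \<open>finite (Oall N \<psi> s)\<close> by (subst Min_gr_iff) (auto simp: Oall_iff)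
  have smax_ge: "\<bar>s t\<bar> \<le> smax N s" if "t < N" for t
    unfolding smax_def using that by (intro Max_ge) auto
  define H where "H = gnorm N g d"
  define \<beta> where "\<beta> = A * H"
  \<comment> \<open>Chosen so that |\<rho> s(t)| is at least c + \<beta> for t in O: a perturbation
    of size \<beta> then cannot bring the argument back inside (-c, c).\<close>
  define \<rho> where "\<rho> = (c + \<beta>) / smin N \<psi> s"
  define G where "G t \<tau> = MpIQ n N a b w (pulse \<tau> (n - 1)) t $ (m - 1)" for t \<tau>
  have m': "m - 1 < n" using m n by linarith
  have G: "MpIQ n N a b w (forcing f) t $ (m - 1) = (\<Sum>\<tau> = 0..<N. G t \<tau> * f \<tau>)" if "t < N" for f t
    unfolding G_def using that m' by (intro MpIQ_forcing) auto
  have G_bound: "\<bar>\<Sum>\<tau> = 0..<N. G t \<tau> * f \<tau>\<bar> \<le> \<beta>" if "t < N" "\<And>\<tau>. \<tau> < N \<Longrightarrow> \<bar>f \<tau>\<bar> \<le> H" for f t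
    unfolding G[OF that(1), symmetric] \<beta>_def A using that m' by (intro MpIQ_forcing_bound) auto
  have g_le: "\<bar>g (real t, x)\<bar> \<le> H" if "t < N" "\<bar>x\<bar> \<le> d" for t x
    unfolding H_def using g that by (rule abs_le_gnorm)
  \<comment> \<open>The bound for zero coefficients \<open>f\<close> already yields 0 \<le> \<beta>,
    so the sign of \<open>A\<close> needs no argument of its own.\<close>
  have "0 \<le> H" using g_le[OF N_pos, of 0] cd by force
  then have \<beta>_nonneg: "0 \<le> \<beta>" using G_bound[OF N_pos, of "\<lambda>_. 0"] by simp
  have \<rho>_nonneg: "0 \<le> \<rho>" unfolding \<rho>_def using \<beta>_nonneg cd smin_pos by simp
  \<comment> \<open>This identity is the origin of (C3): it says that all arguments of
    \<open>g\<close> stay below \<open>d\<close> in absolute value.\<close>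
  have "\<rho> * smax N s + \<beta> = (c * smax N s + A * gnorm N g d * (smax N s + smin N \<psi> s)) / smin N \<psi> s"
    using smin_pos unfolding \<rho>_def \<beta>_def H_def by (simp add: field_simps)
  then have \<rho>_smax: "\<rho> * smax N s + \<beta> < d" using C3 by simp
  have range: "\<bar>\<alpha> * s t + z t\<bar> \<le> d" if "\<bar>\<alpha>\<bar> \<le> \<rho>" "\<bar>z t\<bar> \<le> \<beta>" "t < N" for \<alpha> t and z :: "nat \<Rightarrow> real"
  proof -
    have "\<bar>\<alpha> * s t\<bar> \<le> \<rho> * smax N s"
      unfolding abs_mult using that smax_ge \<rho>_nonneg by (intro mult_mono) auto
    then show ?thesis using that(2) \<rho>_smax abs_triangle_ineq[of "\<alpha> * s t" "z t"] by linarith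
  qed
  have \<rho>_smin: "\<rho> * smin N \<psi> s = c + \<beta>" unfolding \<rho>_def using smin_pos by simp
  have large: "c \<le> \<rho> * s t + z \<and> - \<rho> * s t + z \<le> - c" if "t \<in> Oall N \<psi> s" "0 < s t" "\<bar>z\<bar> \<le> \<beta>" for t z
    using mult_left_mono[OF smin_le[OF that(1)] \<rho>_nonneg] that(2,3) unfolding \<rho>_smin by auto
  have small: "\<rho> * s t + z \<le> - c \<and> c \<le> - \<rho> * s t + z" if "t \<in> Oall N \<psi> s" "s t < 0" "\<bar>z\<bar> \<le> \<beta>" for t z
    using mult_left_mono[OF smin_le[OF that(1)] \<rho>_nonneg] that(2,3) unfolding \<rho>_smin by auto
  \<comment> \<open>By (C1) a nonzero \<psi>(t) entails a nonzero s(t), so \<psi> vanishes off O and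
    the default value 0 in \<open>glue\<close> agrees with the true term there.\<close>
  have off: "\<psi> t = 0" if "t < N" "t \<notin> Oall N \<psi> s" for t
    using that C1 by (auto simp: Oall_iff Ozero_def)
  have pos: "0 \<le> (\<Sum>t = 0..<N. \<psi> t * g (real t, \<rho> * s t + z t))"
    if z: "\<And>\<tau>. \<tau> < N \<Longrightarrow> \<bar>z \<tau>\<bar> \<le> \<beta>" for z
  proof -
    \<comment> \<open>The sign of s(t) decides which of the intervals [c, d] and [-d, -c] contains
      the argument, and the sign of \<psi>(t) orients the inequality of (C2); in all four classes
      the term of J_1 is a lower bound.\<close>
    have "\<psi> t * glue N \<psi> s W1 w1 W2 w2 t \<le> \<psi> t * g (real t, \<rho> * s t + z t)" if "t \<in> {0..<N}" for t
    proof -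
      let ?x = "\<rho> * s t + z t"
      have t: "t < N" using that by simp
      have x: "\<bar>?x\<bar> \<le> d" using range[of \<rho> z t] z[OF t] t \<rho>_nonneg by simp
      consider "\<psi> t = 0" | "t \<in> Opp N \<psi> s" | "t \<in> Opm N \<psi> s" | "t \<in> Omp N \<psi> s" | "t \<in> Omm N \<psi> s"
        using off[OF t] by (auto simp: Oall_def)
      then show ?thesis
      proof cases
        case 2
        then have "?x \<in> {c..d}" using x large[OF _ _ z[OF t], of t] by (auto simp: Oall_def Opp_def)
        then have "W1 t < g (real t, ?x)" using C2pp 2 by blast
        then show ?thesis using 2 by (auto simp: glue_def Opp_def)
      next
        case 3
        then have "?x \<in> {-d..-c}" using x small[OF _ _ z[OF t], of t] by (auto simp: Oall_def Opm_def)
        then have "w1 t < g (real t, ?x)" using C2pm 3 by blast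
        then show ?thesis using 3 by (auto simp: glue_def Opp_def Opm_def)
      next
        case 4
        then have "?x \<in> {c..d}" using x large[OF _ _ z[OF t], of t] by (auto simp: Oall_def Omp_def)
        then have "g (real t, ?x) < W2 t" using C2mp 4 by blast
        then show ?thesis using 4 by (auto simp: glue_def Opp_def Opm_def Omp_def)
      next
        case 5
        then have "?x \<in> {-d..-c}" using x small[OF _ _ z[OF t], of t] by (auto simp: Oall_def Omm_def)
        then have "g (real t, ?x) < w2 t" using C2mm 5 by blast
        then show ?thesis using 5 by (auto simp: glue_def Opp_def Opm_def Omp_def Omm_def)
      qed simp
    qed
    then have "J1 \<le> (\<Sum>t = 0..<N. \<psi> t * g (real t, \<rho> * s t + z t))"
      unfolding J1 by (rule sum_mono)
    then show ?thesis using C4 by linarith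
  qed
  have neg: "(\<Sum>t = 0..<N. \<psi> t * g (real t, - \<rho> * s t + z t)) \<le> 0"
    if z: "\<And>\<tau>. \<tau> < N \<Longrightarrow> \<bar>z \<tau>\<bar> \<le> \<beta>" for z
  proof -
    \<comment> \<open>With \<alpha> = -\<rho> the two intervals change places, so the other half of
      (C2) applies and gives upper bounds by the terms of J_2.\<close>
    have "\<psi> t * g (real t, - \<rho> * s t + z t) \<le> \<psi> t * glue N \<psi> s U1 u1 U2 u2 t" if "t \<in> {0..<N}" for t
    proof -
      let ?x = "- \<rho> * s t + z t"
      have t: "t < N" using that by simp
      have x: "\<bar>?x\<bar> \<le> d" using range[of "- \<rho>" z t] z[OF t] t \<rho>_nonneg by simp
      consider "\<psi> t = 0" | "t \<in> Opp N \<psi> s" | "t \<in> Opm N \<psi> s" | "t \<in> Omp N \<psi> s" | "t \<in> Omm N \<psi> s"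
        using off[OF t] by (auto simp: Oall_def)
      then show ?thesis
      proof cases
        case 2
        then have "?x \<in> {-d..-c}" using x large[OF _ _ z[OF t], of t] by (auto simp: Oall_def Opp_def)
        then have "g (real t, ?x) < U1 t" using C2pp 2 by blast
        then show ?thesis using 2 by (auto simp: glue_def Opp_def)
      next
        case 3
        then have "?x \<in> {c..d}" using x small[OF _ _ z[OF t], of t] by (auto simp: Oall_def Opm_def)
        then have "g (real t, ?x) < u1 t" using C2pm 3 by blast
        then show ?thesis using 3 by (auto simp: glue_def Opp_def Opm_def)
      next
        case 4
        then have "?x \<in> {-d..-c}" using x large[OF _ _ z[OF t], of t] by (auto simp: Oall_def Omp_def)
        then have "U2 t < g (real t, ?x)" using C2mp 4 by blast
        then show ?thesis using 4 by (auto simp: glue_def Opp_def Opm_def Omp_def)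
      next
        case 5
        then have "?x \<in> {c..d}" using x small[OF _ _ z[OF t], of t] by (auto simp: Oall_def Omm_def)
        then have "u2 t < g (real t, ?x)" using C2mm 5 by blast
        then show ?thesis using 5 by (auto simp: glue_def Opp_def Opm_def Omp_def Omm_def)
      qed simp
    qed
    then have "(\<Sum>t = 0..<N. \<psi> t * g (real t, - \<rho> * s t + z t)) \<le> J2"
      unfolding J2 by (rule sum_mono)
    then show ?thesis using C4 by linarith
  qed
  have cont: "continuous_on UNIV (\<lambda>x. g (real t, x))" for t
    by (rule continuous_on_compose2[OF g]) (auto intro!: continuous_intros)
  have bound: "\<bar>\<Sum>\<tau> = 0..<N. G t \<tau> * g (real \<tau>, \<alpha> * s \<tau> + z \<tau>)\<bar> \<le> \<beta>"
    if "\<bar>\<alpha>\<bar> \<le> \<rho>" "\<And>\<tau>. \<tau> < N \<Longrightarrow> \<bar>z \<tau>\<bar> \<le> \<beta>" "t < N" for \<alpha> z t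
    using that by (intro G_bound g_le range) auto
  obtain \<alpha> z where z: "\<And>t. t < N \<Longrightarrow> z t = (\<Sum>\<tau> = 0..<N. G t \<tau> * g (real \<tau>, \<alpha> * s \<tau> + z \<tau>))"
    and ortho: "(\<Sum>t = 0..<N. \<psi> t * g (real t, \<alpha> * s t + z t)) = 0"
  proof (rule bifurcation_equation_solvable[where f = "\<lambda>t x. g (real t, x)",
        OF cont \<rho>_nonneg \<beta>_nonneg bound pos neg])
    fix \<alpha> z
    assume "\<And>t. t < N \<Longrightarrow> z t = (\<Sum>\<tau> = 0..<N. G t \<tau> * g (real \<tau>, \<alpha> * s \<tau> + z \<tau>))"
      "(\<Sum>t = 0..<N. \<psi> t * g (real t, \<alpha> * s t + z t)) = 0"
    then show thesis by (rule that)
  qed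
  define f where "f t = g (real t, \<alpha> * s t + z t)" for t
  define x where "x t = \<alpha> \<cdot>\<^sub>v Svec n a u t + MpIQ n N a b w (forcing f) t" for t
  have "(\<Sum>t = 0..<N. Psi_n n N a b w t * f t) = 0"
    using ortho by (simp add: f_def \<psi>)
  note x = boundary_value_solution[where \<alpha> = \<alpha>, OF this, folded x_def]
  \<comment> \<open>Closes the loop: the equation for z(t) says that it is the m-th component of the
    M_p term, so \<open>f t\<close> is \<open>g\<close> evaluated at the m-th component of the
    constructed x(t).\<close>
  have x_m: "x t $ (m - 1) = \<alpha> * s t + z t" if t: "t < N" for t
    using MpIQ_carrier[OF forcing_in_Zspace, of t f] t m' G[OF t, of f] z[OF t]
      mult_vec_carrier(3)[OF u_carrier, of t]
    by (simp add: x_def s S_m_def Svec_def f_def del: index_mult_mat_vec)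
  have forcing_index: "forcing f t $ i = (if i = n - 1 then f t else 0)" if "t < N" "i < n" for t i
    using that by (simp add: forcing_def)
  have step: "x (Suc t) $ i = (C t *\<^sub>v x t) $ i + forcing f t $ i" if "t < N" "i < n" for t i
    unfolding x(2)[OF that(1)]
    using that carrier_vecD[OF Zspace_mem[OF forcing_in_Zspace that(1)]] by (intro index_add_vec(1)) simp
  have shift: "x (Suc t) $ i = x t $ Suc i" if "t < N" "Suc i < n" for t i
  proof -
    have "(C t *\<^sub>v x t) $ i = x t $ Suc i"
      using x(1)[of t] that by (intro companion_mult_vec_shift) auto
    then show ?thesis
      using step[of t i] forcing_index[of t i] that by auto
  qed
  obtain y where y: "\<And>t j. t \<le> N \<Longrightarrow> j < n \<Longrightarrow> y (t + j) = x t $ j"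
    using shift_orbit_scalar[of N n x, OF shift] by blast
  show ?thesis
  proof (intro exI conjI ballI)
    fix t assume "t \<in> {0..<N}"
    then have t: "t < N" by simp
    \<comment> \<open>The index t + n is (t + 1) + (n - 1), so the top value is the last component
      at time t + 1, which is still at most \<open>N\<close>.\<close>
    have "y (t + n) = x (Suc t) $ (n - 1)"
      using y[of "Suc t" "n - 1"] t n by simp
    also have "\<dots> = - (\<Sum>j = 0..<n. a j t * x t $ j) + f t"
      using step[OF t, of "n - 1"] forcing_index[OF t, of "n - 1"] companion_mult_vec_last[of n "x t" a t]
        x(1)[of t] t n by simp
    also have "(\<Sum>j = 0..<n. a j t * x t $ j) = (\<Sum>j = 0..<n. a j t * y (t + j))"
      using y t by (intro sum.cong refl) auto
    also have "f t = g (real t, y (t + m - 1))"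
      using x_m[OF t] y[of t "m - 1"] t m m' by (simp add: f_def)
    finally show "y (t + n) + (\<Sum>j = 0..<n. a j t * y (t + j)) = g (real t, y (t + m - 1))" by simp
  next
    fix i assume i: "i \<in> {1..n}"
    then have i': "i - 1 < n" by auto
    have c: "(\<lambda>k. B k *\<^sub>v x k) \<in> {0..N} \<rightarrow> carrier_vec n"
      using x(1) by (intro Pi_I mult_vec_carrier) simp
    have "(\<Sum>k = 0..N. \<Sum>j = 1..n. b i j k * y (j + k - 1)) = (\<Sum>k = 0..N. (B k *\<^sub>v x k) $ (i - 1))"
    proof (intro sum.cong refl)
      fix k assume k: "k \<in> {0..N}"
      \<comment> \<open>Since j starts at 1, the natural-number subtraction in j + k - 1 is exact;
        shifting j to start at 0 matches the indexing of \<open>bmat\<close>.\<close>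
      have "(\<Sum>j = 1..n. b i j k * y (j + k - 1)) = (\<Sum>j = 0..<n. b i (Suc j) k * y (k + j))"
        by (simp add: sum.atLeast1_atMost_eq lessThan_atLeast0 add.commute)
      also have "\<dots> = (\<Sum>j = 0..<n. B k $$ (i - 1, j) * x k $ j)"
        using y k i i' by (intro sum.cong refl) (simp add: bmat_def)
      also have "\<dots> = (B k *\<^sub>v x k) $ (i - 1)"
        using x(1)[of k] k i' by (intro index_mult_mat_vec_sum[symmetric, OF bmat_carrier]) auto
      finally show "(\<Sum>j = 1..n. b i j k * y (j + k - 1)) = (B k *\<^sub>v x k) $ (i - 1)" .
    qed
    also have "\<dots> = boundary x $ (i - 1)"
      by (rule index_finsum_vec[OF _ i' c, symmetric]) simp
    also have "\<dots> = 0" using x(3) i' by simp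
    finally show "(\<Sum>k = 0..N. \<Sum>j = 1..n. b i j k * y (j + k - 1)) = 0" .
  qed
qed

end
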